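(* Let $\omega^1,\dots,\omega^4$ be a basis of $\Lambda^{1,0}(\mathbb C^4)^*$, and let $\varphi^1=\omega^{12}$, $\varphi^2=\omega^{13}$, $\varphi^3=\omega^{14}$, $\varphi^4=\omega^{23}$, $\varphi^5=-\omega^{24}$, $\varphi^6=\omega^{34}$. Fix $1\le j<k\le 6$ and for $a\in\mathbb C$ set $$\Omega_a=\sum_{l=1}^6\varphi^l\wedge\overline{\varphi^l}+a\,\varphi^j\wedge\overline{\varphi^k}+\bar a\,\varphi^k\wedge\overline{\varphi^j}.$$ If $j+k=7$, then: 1. $\Omega_a$ is weakly positive if and only if $|a|\le2$. 2. $\Omega_a$ is strictly weakly positive if and only if $|a|<2$. 3. The following are equivalent: (i) $\Omega_a$ is Hermitian positive; (ii) $\Omega_a$ is strongly positive; (iii) $|a|\le1$. 4. The following are equivalent: (i) $\Omega_a$ is strictly Hermitian positive; (ii) $\Omega_a$ is strictly strongly positive; (iii) $|a|<1$.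
   Context: $\omega^{jk}=\omega^j\wedge\omega^k$. The volume form is $\mathrm{Vol}=\omega^1\wedge\omega^2\wedge\omega^3\wedge\omega^4\wedge\bar\omega^1\wedge\bar\omega^2\wedge\bar\omega^3\wedge\bar\omega^4$; a $(4,4)$-form is non-negative (resp. strictly positive) if it is a non-negative (resp. positive) real multiple of $\mathrm{Vol}$. A $(2,0)$-form is decomposable if it is of the form $\mu_1\wedge\mu_2$ with $\mu_1,\mu_2$ of type $(1,0)$. A real $(2,2)$-form $\Omega$ on $\mathbb C^4$ is: - strongly positive if it is a finite sum $\sum_j\psi_j\wedge\bar\psi_j$ with $\psi_j$ decomposable $(2,0)$-forms; strictly strongly positive if it lies in the interior of the cone of strongly positive forms (interior in the real vector space of real $(2,2)$-forms); - Hermitian positive (resp. strictly Hermitian positive) if $\Omega\wedge\eta\wedge\bar\eta$ is non-negative for all $\eta\in\Lambda^{2,0}(\mathbb C^4)^*$ (resp. strictly positive for all non-zero such $\eta$); - weakly positive (resp. strictly weakly positive) if $\Omega\wedge\psi\wedge\bar\psi$ is non-negative for all decomposable $(2,0)$-forms $\psi$ (resp. strictly positive for all non-zero decomposable $\psi$). *)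

theory Defs
  imports "HOL-Analysis.Analysis" "HOL-Library.Function_Algebras"
begin

text \<open>
  Complex-valued constant-coefficient forms on \<open>\<complex>\<^sup>4\<close> (regarded as a real vector space) are
  represented as functions on lists of vectors: a form of degree \<open>n\<close> is alternating and
  real-multilinear on lists of length \<open>n\<close> and vanishes on lists of every other length.
  Addition, zero and negation of forms are the pointwise ones, and the topology on the type is
  that of pointwise convergence.
\<close>

type_synonym form = "(complex^4) list \<Rightarrow> complex"

definition scale_form :: "complex \<Rightarrow> form \<Rightarrow> form" (infixr "*\<^sub>C" 75)
  where "c *\<^sub>C \<alpha> = (\<lambda>vs. c * \<alpha> vs)"

global_interpretation forms: vector_space scale_form
  by unfold_locales
    (simp_all add: scale_form_def plus_fun_def algebra_simps)

definition conj_form :: "form \<Rightarrow> form"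
  where "conj_form \<alpha> = (\<lambda>vs. cnj (\<alpha> vs))"

text \<open>
  The exterior product, as the sum over shuffles: \<open>A\<close> is the set of positions whose arguments go to
  the left factor (in increasing order), and the sign is that of the corresponding shuffle.
  Only sets \<open>A\<close> of size the degree of \<open>\<alpha>\<close> contribute. No factorial factors occur, so that
  \<open>\<mu> \<and> \<nu>\<close> maps \<open>[v, w]\<close> to \<open>\<mu> [v] * \<nu> [w] - \<mu> [w] * \<nu> [v]\<close> for forms of degree one.
\<close>

definition wedge :: "form \<Rightarrow> form \<Rightarrow> form" (infixl "\<^bold>\<and>" 80)
  where "\<alpha> \<^bold>\<and> \<beta> = (\<lambda>vs. \<Sum>A\<in>Pow {..<length vs}.
    (-1) ^ card {(i, j). i \<in> A \<and> j \<in> {..<length vs} - A \<and> j < i}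
      * \<alpha> (nths vs A) * \<beta> (nths vs (- A)))"

definition form_of_functional :: "(complex^4 \<Rightarrow> complex) \<Rightarrow> form"
  where "form_of_functional f = (\<lambda>vs. if length vs = 1 then f (hd vs) else 0)"

definition Lambda_1_0 :: "form set"
  where "Lambda_1_0 = {form_of_functional f | f. Vector_Spaces.linear (*s) (*) f}"

definition decomposable_2_0 :: "form set"
  where "decomposable_2_0 = {\<mu>1 \<^bold>\<and> \<mu>2 | \<mu>1 \<mu>2. \<mu>1 \<in> Lambda_1_0 \<and> \<mu>2 \<in> Lambda_1_0}"

definition Lambda_2_0 :: "form set"
  where "Lambda_2_0 = forms.span decomposable_2_0"

definition Lambda_2_2 :: "form set"
  where "Lambda_2_2 = forms.span
    {\<eta> \<^bold>\<and> conj_form \<theta> | \<eta> \<theta>. \<eta> \<in> Lambda_2_0 \<and> \<theta> \<in> Lambda_2_0}"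

definition real_Lambda_2_2 :: "form set"
  where "real_Lambda_2_2 = {\<Omega> \<in> Lambda_2_2. conj_form \<Omega> = \<Omega>}"

definition basis_1_0 :: "(nat \<Rightarrow> form) \<Rightarrow> bool"
  where "basis_1_0 \<omega> \<longleftrightarrow> inj_on \<omega> {1..4} \<and> forms.independent (\<omega> ` {1..4})
    \<and> forms.span (\<omega> ` {1..4}) = Lambda_1_0"

definition Vol :: "(nat \<Rightarrow> form) \<Rightarrow> form"
  where "Vol \<omega> = \<omega> 1 \<^bold>\<and> \<omega> 2 \<^bold>\<and> \<omega> 3 \<^bold>\<and> \<omega> 4
    \<^bold>\<and> conj_form (\<omega> 1) \<^bold>\<and> conj_form (\<omega> 2) \<^bold>\<and> conj_form (\<omega> 3) \<^bold>\<and> conj_form (\<omega> 4)"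

definition nonneg_form :: "(nat \<Rightarrow> form) \<Rightarrow> form \<Rightarrow> bool"
  where "nonneg_form \<omega> \<alpha> \<longleftrightarrow> (\<exists>r::real. r \<ge> 0 \<and> \<alpha> = complex_of_real r *\<^sub>C Vol \<omega>)"

definition pos_form :: "(nat \<Rightarrow> form) \<Rightarrow> form \<Rightarrow> bool"
  where "pos_form \<omega> \<alpha> \<longleftrightarrow> (\<exists>r::real. r > 0 \<and> \<alpha> = complex_of_real r *\<^sub>C Vol \<omega>)"

definition strongly_positive :: "form \<Rightarrow> bool"
  where "strongly_positive \<Omega> \<longleftrightarrow> \<Omega> \<in> real_Lambda_2_2 \<and>
    (\<exists>(n::nat) \<psi>. (\<forall>i<n. \<psi> i \<in> decomposable_2_0) \<and> \<Omega> = (\<Sum>i<n. \<psi> i \<^bold>\<and> conj_form (\<psi> i)))"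

text \<open>
  The subspace topology induced on the finite-dimensional space of real \<open>(2,2)\<close>-forms by pointwise
  convergence is its unique Hausdorff vector space topology.
\<close>

definition strictly_strongly_positive :: "form \<Rightarrow> bool"
  where "strictly_strongly_positive \<Omega> \<longleftrightarrow>
    \<Omega> \<in> top_of_set real_Lambda_2_2 interior_of {\<Theta>. strongly_positive \<Theta>}"

definition hermitian_positive :: "(nat \<Rightarrow> form) \<Rightarrow> form \<Rightarrow> bool"
  where "hermitian_positive \<omega> \<Omega> \<longleftrightarrow> \<Omega> \<in> real_Lambda_2_2 \<and>
    (\<forall>\<eta>\<in>Lambda_2_0. nonneg_form \<omega> (\<Omega> \<^bold>\<and> \<eta> \<^bold>\<and> conj_form \<eta>))"

definition strictly_hermitian_positive :: "(nat \<Rightarrow> form) \<Rightarrow> form \<Rightarrow> bool"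
  where "strictly_hermitian_positive \<omega> \<Omega> \<longleftrightarrow> \<Omega> \<in> real_Lambda_2_2 \<and>
    (\<forall>\<eta>\<in>Lambda_2_0. \<eta> \<noteq> 0 \<longrightarrow> pos_form \<omega> (\<Omega> \<^bold>\<and> \<eta> \<^bold>\<and> conj_form \<eta>))"

definition weakly_positive :: "(nat \<Rightarrow> form) \<Rightarrow> form \<Rightarrow> bool"
  where "weakly_positive \<omega> \<Omega> \<longleftrightarrow> \<Omega> \<in> real_Lambda_2_2 \<and>
    (\<forall>\<psi>\<in>decomposable_2_0. nonneg_form \<omega> (\<Omega> \<^bold>\<and> \<psi> \<^bold>\<and> conj_form \<psi>))"

definition strictly_weakly_positive :: "(nat \<Rightarrow> form) \<Rightarrow> form \<Rightarrow> bool"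
  where "strictly_weakly_positive \<omega> \<Omega> \<longleftrightarrow> \<Omega> \<in> real_Lambda_2_2 \<and>
    (\<forall>\<psi>\<in>decomposable_2_0. \<psi> \<noteq> 0 \<longrightarrow> pos_form \<omega> (\<Omega> \<^bold>\<and> \<psi> \<^bold>\<and> conj_form \<psi>))"

text \<open>Indexed by \<open>1, \<dots>, 6\<close>; the value at any other index is irrelevant.\<close>

definition phi :: "(nat \<Rightarrow> form) \<Rightarrow> nat \<Rightarrow> form"
  where "phi \<omega> l =
    (if l = 1 then \<omega> 1 \<^bold>\<and> \<omega> 2
     else if l = 2 then \<omega> 1 \<^bold>\<and> \<omega> 3
     else if l = 3 then \<omega> 1 \<^bold>\<and> \<omega> 4
     else if l = 4 then \<omega> 2 \<^bold>\<and> \<omega> 3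
     else if l = 5 then - (\<omega> 2 \<^bold>\<and> \<omega> 4)
     else if l = 6 then \<omega> 3 \<^bold>\<and> \<omega> 4
     else 0)"

definition Omega :: "(nat \<Rightarrow> form) \<Rightarrow> nat \<Rightarrow> nat \<Rightarrow> complex \<Rightarrow> form"
  where "Omega \<omega> j k a = (\<Sum>l=1..6. phi \<omega> l \<^bold>\<and> conj_form (phi \<omega> l))
    + a *\<^sub>C phi \<omega> j \<^bold>\<and> conj_form (phi \<omega> k)
    + cnj a *\<^sub>C phi \<omega> k \<^bold>\<and> conj_form (phi \<omega> j)"

end

theory Submission
  imports Defs
begin

text \<open>
  Everything is read off in the six coordinates \<open>x\<^sub>1, \<dots>, x\<^sub>6\<close> of a \<open>(2,0)\<close>-form
  \<open>\<eta> = \<Sum> x\<^sub>l \<phi>\<^sup>l\<close>. The signs in the \<open>\<phi>\<^sup>l\<close> are chosen so that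
  \<open>\<phi>\<^sup>l \<and> \<phi>\<^sup>m\<close> is \<open>\<omega>\<^sup>1\<^sup>2\<^sup>3\<^sup>4\<close> for \<open>l + m = 7\<close> and zero otherwise. Hence
  \<open>\<eta>\<close> is decomposable exactly when \<open>\<eta> \<and> \<eta> = 0\<close>, that is, when
  \<open>x\<^sub>1 x\<^sub>6 + x\<^sub>2 x\<^sub>5 + x\<^sub>3 x\<^sub>4 = 0\<close> (the Klein quadric), and for \<open>j + k = 7\<close> the form
  \<open>\<Omega>\<^sub>a \<and> \<eta> \<and> \<eta>\<^sup>*\<close>, where the star denotes conjugation, is the multiple of the volume form by
  \<open>\<Sum> |x\<^sub>l|\<^sup>2 + 2 Re (a x\<^sub>k x\<^sub>j\<^sup>*)\<close>.

  On all of \<open>\<complex>\<^sup>6\<close> the sharp estimate is \<open>2 |x\<^sub>j x\<^sub>k| \<le> \<Sum> |x\<^sub>l|\<^sup>2\<close>, which gives the threshold 1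
  for Hermitian positivity. On the Klein quadric \<open>x\<^sub>j x\<^sub>k\<close> is minus the sum of the other two products,
  so its modulus is bounded by half of the sum of the other four squares as well as by half of
  \<open>|x\<^sub>j|\<^sup>2 + |x\<^sub>k|\<^sup>2\<close>. Adding up, \<open>4 |x\<^sub>j x\<^sub>k| \<le> \<Sum> |x\<^sub>l|\<^sup>2\<close>, and the threshold for weak positivity
  rises to 2.

  A strongly positive form is Hermitian positive because
  \<open>\<psi> \<and> \<psi>\<^sup>* \<and> \<eta> \<and> \<eta>\<^sup>*\<close> is \<open>|s|\<^sup>2\<close> times the volume form when \<open>\<psi> \<and> \<eta> = s \<omega>\<^sup>1\<^sup>2\<^sup>3\<^sup>4\<close>. Conversely, for
  \<open>|a| \<le> 1\<close> the form \<open>\<Omega>\<^sub>a\<close> is written as a sum of decomposable squares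
  (\<open>strongly_positive_omega_mat\<close>): the vector \<open>\<phi>\<^sup>j + a\<^sup>* \<phi>\<^sup>k\<close>, which would produce the off-diagonal
  terms, does not lie on the quadric when \<open>a \<noteq> 0\<close>, so multiples of another complementary pair
  \<open>\<phi>\<^sup>p\<close>, \<open>\<phi>\<^sup>7\<^sup>-\<^sup>p\<close> are added to correct it, and averaging over a phase cancels the unwanted
  cross terms.

  For the interior, a real \<open>(2,2)\<close>-form is given by a Hermitian \<open>6 \<times> 6\<close> matrix, whose entries
  depend continuously on the form. If \<open>|a| < 1\<close>, a multiple \<open>1 - |a|\<close> of the identity
  matrix can be split off from that of \<open>\<Omega>\<^sub>a\<close>, and it absorbs any small Hermitian perturbation entry by
  entry. In the other direction, subtracting a small multiple of \<open>\<Omega>\<^sub>0\<close> from an interior point leaves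
  a Hermitian positive form, so the quadratic form of \<open>\<Omega>\<^sub>a\<close> is positive definite.
\<close>

section \<open>The exterior product as a signed shuffle product\<close>

text \<open>
  Associativity and graded commutativity of the exterior product are awkward to obtain from sums over
  sets of positions. The antiderivation rule for the interior product (\<open>wedge_Cons\<close>) describes the
  product by recursion on the list of arguments, and both laws then follow by list induction.
\<close>
definition interior_prod :: "complex^4 \<Rightarrow> form \<Rightarrow> form"
  where "interior_prod v \<alpha> = (\<lambda>vs. \<alpha> (v # vs))"

definition grade_invol :: "form \<Rightarrow> form"
  where "grade_invol \<alpha> = (\<lambda>vs. (- 1) ^ length vs * \<alpha> vs)"

definition homogeneous :: "nat \<Rightarrow> form \<Rightarrow> bool"
  where "homogeneous p \<alpha> \<longleftrightarrow> (\<forall>vs. length vs \<noteq> p \<longrightarrow> \<alpha> vs = 0)"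

lemma wedge_Nil: "(\<alpha> \<^bold>\<and> \<beta>) [] = \<alpha> [] * \<beta> []"
  by (simp add: wedge_def)

abbreviation inversions :: "nat \<Rightarrow> nat set \<Rightarrow> (nat \<times> nat) set"
  where "inversions n A \<equiv> {(i, j). i \<in> A \<and> j \<in> {..<n} - A \<and> j < i}"

lemma finite_inversions: "A \<subseteq> {..<n} \<Longrightarrow> finite (inversions n A)"
  by (rule finite_subset[of _ "{..<n} \<times> {..<n}"]) auto

lemma card_inversions_first:
  "card (inversions (Suc n) (insert 0 (Suc ` B))) = card (inversions n B)"
proof -
  have "x \<in> inversions (Suc n) (insert 0 (Suc ` B)) \<longleftrightarrow> x \<in> map_prod Suc Suc ` inversions n B"
    for x
    by (cases x; cases "fst x"; cases "snd x") (auto simp: image_iff)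
  then have "inversions (Suc n) (insert 0 (Suc ` B)) = map_prod Suc Suc ` inversions n B"
    by blast
  then show ?thesis
    by (simp add: card_image inj_on_def)
qed

lemma card_inversions_other:
  assumes "B \<subseteq> {..<n}"
  shows "card (inversions (Suc n) (Suc ` B)) = card B + card (inversions n B)"
proof -
  have "x \<in> inversions (Suc n) (Suc ` B)
      \<longleftrightarrow> x \<in> (\<lambda>i. (Suc i, 0)) ` B \<union> map_prod Suc Suc ` inversions n B" for x
    by (cases x; cases "fst x"; cases "snd x") (auto simp: image_iff)
  then have *: "inversions (Suc n) (Suc ` B)
      = (\<lambda>i. (Suc i, 0)) ` B \<union> map_prod Suc Suc ` inversions n B"
    by blast
  have "finite B"
    using assms finite_subset by blast
  then show ?thesis
    unfolding * using finite_inversions[OF assms]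
    by (subst card_Un_disjoint) (auto simp: card_image inj_on_def)
qed

text \<open>
  The first argument \<open>v\<close> goes to the left or to the right factor. To the left it creates no inversion;
  to the right it creates one with each position assigned to the left factor, whence the sign
  \<open>grade_invol\<close>.
\<close>

lemma wedge_Cons:
  "(\<alpha> \<^bold>\<and> \<beta>) (v # vs)
    = (interior_prod v \<alpha> \<^bold>\<and> \<beta>) vs + (grade_invol \<alpha> \<^bold>\<and> interior_prod v \<beta>) vs"
proof -
  let ?n = "length vs"
  let ?F = "\<lambda>A. (-1) ^ card (inversions (Suc ?n) A)
      * \<alpha> (nths (v # vs) A) * \<beta> (nths (v # vs) (- A))"
  have Pow_eq: "Pow {..<Suc ?n} = image Suc ` Pow {..<?n} \<union> (\<lambda>B. insert 0 (Suc ` B)) ` Pow {..<?n}"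
    by (simp only: lessThan_Suc_eq_insert_0 Pow_insert image_Pow_surj[OF refl, symmetric] image_image)
  have first: "?F (insert 0 (Suc ` B)) = (-1) ^ card (inversions ?n B)
      * interior_prod v \<alpha> (nths vs B) * \<beta> (nths vs (- B))" for B
  proof -
    have "{j. Suc j \<in> insert 0 (Suc ` B)} = B" "{j. Suc j \<in> - insert 0 (Suc ` B)} = - B"
      by auto
    then show ?thesis
      unfolding card_inversions_first by (simp add: nths_Cons interior_prod_def)
  qed
  have other: "?F (Suc ` B) = (-1) ^ card (inversions ?n B)
      * grade_invol \<alpha> (nths vs B) * interior_prod v \<beta> (nths vs (- B))" if "B \<subseteq> {..<?n}" for B
  proof -
    have *: "{j. Suc j \<in> Suc ` B} = B" "{j. Suc j \<in> - (Suc ` B)} = - B"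
      by auto
    have "{i. i < ?n \<and> i \<in> B} = B"
      using that by auto
    then have "length (nths vs B) = card B"
      by (simp add: length_nths)
    then show ?thesis
      unfolding card_inversions_other[OF that] using *
      by (simp add: nths_Cons interior_prod_def grade_invol_def power_add image_iff)
  qed
  have "(\<alpha> \<^bold>\<and> \<beta>) (v # vs) = sum ?F (Pow {..<Suc ?n})"
    by (simp add: wedge_def)
  also have "\<dots> = sum ?F (image Suc ` Pow {..<?n}) + sum ?F ((\<lambda>B. insert 0 (Suc ` B)) ` Pow {..<?n})"
    unfolding Pow_eq by (rule sum.union_disjoint) auto
  also have "sum ?F (image Suc ` Pow {..<?n}) = (\<Sum>B\<in>Pow {..<?n}. ?F (Suc ` B))"
    by (subst sum.reindex) (auto simp: inj_on_def inj_image_eq_iff)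
  also have "\<dots> = (grade_invol \<alpha> \<^bold>\<and> interior_prod v \<beta>) vs"
    unfolding wedge_def by (rule sum.cong[OF refl], rule other) simp
  also have "sum ?F ((\<lambda>B. insert 0 (Suc ` B)) ` Pow {..<?n}) = (\<Sum>B\<in>Pow {..<?n}. ?F (insert 0 (Suc ` B)))"
  proof (subst sum.reindex)
    show "inj_on (\<lambda>B. insert 0 (Suc ` B)) (Pow {..<?n})"
    proof (rule inj_onI)
      fix B C assume "insert 0 (Suc ` B) = insert 0 (Suc ` C)"
      then have "{j. Suc j \<in> insert 0 (Suc ` B)} = {j. Suc j \<in> insert 0 (Suc ` C)}"
        by simp
      then show "B = C" by (simp add: image_iff)
    qed
  qed simp
  also have "\<dots> = (interior_prod v \<alpha> \<^bold>\<and> \<beta>) vs"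
    unfolding wedge_def by (rule sum.cong[OF refl], rule first)
  finally show ?thesis by simp
qed

lemma interior_prod_wedge:
  "interior_prod v (\<alpha> \<^bold>\<and> \<beta>)
    = interior_prod v \<alpha> \<^bold>\<and> \<beta> + grade_invol \<alpha> \<^bold>\<and> interior_prod v \<beta>"
  by (rule ext) (simp add: interior_prod_def[of v "\<alpha> \<^bold>\<and> \<beta>"] wedge_Cons plus_fun_def)

lemma wedge_add_left: "(\<alpha> + \<beta>) \<^bold>\<and> \<gamma> = \<alpha> \<^bold>\<and> \<gamma> + \<beta> \<^bold>\<and> \<gamma>"
  by (rule ext) (simp add: wedge_def plus_fun_def sum.distrib[symmetric] algebra_simps)

lemma wedge_add_right: "\<alpha> \<^bold>\<and> (\<beta> + \<gamma>) = \<alpha> \<^bold>\<and> \<beta> + \<alpha> \<^bold>\<and> \<gamma>"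
  by (rule ext) (simp add: wedge_def plus_fun_def sum.distrib[symmetric] algebra_simps)

lemma wedge_scale_left: "(c *\<^sub>C \<alpha>) \<^bold>\<and> \<beta> = c *\<^sub>C (\<alpha> \<^bold>\<and> \<beta>)"
  by (rule ext) (simp add: wedge_def scale_form_def sum_distrib_left mult_ac)

lemma wedge_scale_right: "\<alpha> \<^bold>\<and> (c *\<^sub>C \<beta>) = c *\<^sub>C (\<alpha> \<^bold>\<and> \<beta>)"
  by (rule ext) (simp add: wedge_def scale_form_def sum_distrib_left mult_ac)

lemma wedge_zero_left [simp]: "0 \<^bold>\<and> \<alpha> = 0"
  by (rule ext) (simp add: wedge_def zero_fun_def)

lemma wedge_zero_right [simp]: "\<alpha> \<^bold>\<and> 0 = 0"
  by (rule ext) (simp add: wedge_def zero_fun_def)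

lemma wedge_sum_left: "(\<Sum>i\<in>I. f i) \<^bold>\<and> \<alpha> = (\<Sum>i\<in>I. f i \<^bold>\<and> \<alpha>)"
  using sum_comp_morphism[of "\<lambda>\<beta>. \<beta> \<^bold>\<and> \<alpha>" f I] by (simp add: wedge_add_left comp_def)

lemma wedge_sum_right: "\<alpha> \<^bold>\<and> (\<Sum>i\<in>I. f i) = (\<Sum>i\<in>I. \<alpha> \<^bold>\<and> f i)"
  using sum_comp_morphism[of "\<lambda>\<beta>. \<alpha> \<^bold>\<and> \<beta>" f I] by (simp add: wedge_add_right comp_def)

lemma wedge_minus_left: "(- \<alpha>) \<^bold>\<and> \<beta> = - (\<alpha> \<^bold>\<and> \<beta>)"
  by (rule ext) (simp add: wedge_def sum_negf)

lemma wedge_minus_right: "\<alpha> \<^bold>\<and> (- \<beta>) = - (\<alpha> \<^bold>\<and> \<beta>)"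
  by (rule ext) (simp add: wedge_def sum_negf)

lemma conj_form_add: "conj_form (\<alpha> + \<beta>) = conj_form \<alpha> + conj_form \<beta>"
  by (simp add: conj_form_def plus_fun_def)

lemma conj_form_zero [simp]: "conj_form 0 = 0"
  by (simp add: conj_form_def zero_fun_def)

lemma conj_form_scale: "conj_form (c *\<^sub>C \<alpha>) = cnj c *\<^sub>C conj_form \<alpha>"
  by (simp add: conj_form_def scale_form_def)

lemma conj_form_sum: "conj_form (\<Sum>i\<in>I. f i) = (\<Sum>i\<in>I. conj_form (f i))"
  using sum_comp_morphism[of conj_form f I] by (simp add: conj_form_add comp_def)

lemma conj_form_conj_form [simp]: "conj_form (conj_form \<alpha>) = \<alpha>"
  by (simp add: conj_form_def)

lemma conj_form_wedge: "conj_form (\<alpha> \<^bold>\<and> \<beta>) = conj_form \<alpha> \<^bold>\<and> conj_form \<beta>"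
  by (rule ext) (simp add: conj_form_def wedge_def)

lemma grade_invol_wedge: "grade_invol (\<alpha> \<^bold>\<and> \<beta>) = grade_invol \<alpha> \<^bold>\<and> grade_invol \<beta>"
proof
  fix vs :: "(complex^4) list"
  have "length vs = length (nths vs A) + length (nths vs (- A))" for A
  proof -
    have "card {i. i < length vs} = card ({i. i < length vs \<and> i \<in> A} \<union> {i. i < length vs \<and> i \<in> - A})"
      by (rule arg_cong[where f = card]) auto
    also have "\<dots> = card {i. i < length vs \<and> i \<in> A} + card {i. i < length vs \<and> i \<in> - A}"
      by (rule card_Un_disjoint) auto
    finally show ?thesis by (simp add: length_nths)
  qed
  then have "(-1 :: complex) ^ length vs * x
      = (-1) ^ length (nths vs A) * ((-1) ^ length (nths vs (- A)) * x)" for A x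
    by (metis power_add mult.assoc)
  then show "grade_invol (\<alpha> \<^bold>\<and> \<beta>) vs = (grade_invol \<alpha> \<^bold>\<and> grade_invol \<beta>) vs"
    unfolding grade_invol_def wedge_def sum_distrib_left
    by (intro sum.cong refl) (simp add: mult_ac)
qed

lemma wedge_assoc: "\<alpha> \<^bold>\<and> \<beta> \<^bold>\<and> \<gamma> = \<alpha> \<^bold>\<and> (\<beta> \<^bold>\<and> \<gamma>)"
proof
  show "(\<alpha> \<^bold>\<and> \<beta> \<^bold>\<and> \<gamma>) vs = (\<alpha> \<^bold>\<and> (\<beta> \<^bold>\<and> \<gamma>)) vs" for vs
  proof (induction vs arbitrary: \<alpha> \<beta> \<gamma>)
    case Nil
    then show ?case by (simp add: wedge_Nil)
  next
    case (Cons v vs)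
    then show ?case
      by (simp add: wedge_Cons interior_prod_wedge grade_invol_wedge wedge_add_left wedge_add_right)
  qed
qed

lemma homogeneous_interior_prod: "homogeneous (Suc p) \<alpha> \<Longrightarrow> homogeneous p (interior_prod v \<alpha>)"
  by (simp add: homogeneous_def interior_prod_def)

lemma interior_prod_homogeneous_0: "homogeneous 0 \<alpha> \<Longrightarrow> interior_prod v \<alpha> = 0"
  by (auto simp: homogeneous_def interior_prod_def)

lemma grade_invol_homogeneous: "homogeneous p \<alpha> \<Longrightarrow> grade_invol \<alpha> = (-1) ^ p *\<^sub>C \<alpha>"
  by (auto simp: homogeneous_def grade_invol_def scale_form_def fun_eq_iff)

lemma homogeneous_wedge:
  assumes "homogeneous p \<alpha>" "homogeneous q \<beta>"
  shows "homogeneous (p + q) (\<alpha> \<^bold>\<and> \<beta>)"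
  unfolding homogeneous_def
proof (intro allI impI)
  fix vs :: "(complex^4) list"
  show "length vs \<noteq> p + q \<Longrightarrow> (\<alpha> \<^bold>\<and> \<beta>) vs = 0"
    using assms
  proof (induction vs arbitrary: p q \<alpha> \<beta>)
    case Nil
    then show ?case by (auto simp: wedge_Nil homogeneous_def)
  next
    case (Cons v vs)
    have "(interior_prod v \<alpha> \<^bold>\<and> \<beta>) vs = 0"
    proof (cases p)
      case (Suc p')
      then show ?thesis
        using Cons.IH[of p' q] Cons.prems homogeneous_interior_prod by simp
    qed (use Cons.prems in \<open>simp add: interior_prod_homogeneous_0\<close>)
    moreover have "(\<alpha> \<^bold>\<and> interior_prod v \<beta>) vs = 0"
    proof (cases q)
      case (Suc q')
      then show ?thesis
        using Cons.IH[of p q'] Cons.prems homogeneous_interior_prod by simp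
    qed (use Cons.prems in \<open>simp add: interior_prod_homogeneous_0\<close>)
    ultimately show ?case
      using Cons.prems
      by (simp add: wedge_Cons grade_invol_homogeneous wedge_scale_left scale_form_def[of _ "_ \<^bold>\<and> _"])
  qed
qed

lemma wedge_commute:
  assumes "homogeneous p \<alpha>" "homogeneous q \<beta>"
  shows "\<alpha> \<^bold>\<and> \<beta> = (-1) ^ (p * q) *\<^sub>C (\<beta> \<^bold>\<and> \<alpha>)"
proof
  fix vs :: "(complex^4) list"
  show "(\<alpha> \<^bold>\<and> \<beta>) vs = ((-1) ^ (p * q) *\<^sub>C (\<beta> \<^bold>\<and> \<alpha>)) vs"
    using assms
  proof (induction vs arbitrary: p q \<alpha> \<beta>)
    case Nil
    show ?case
    proof (cases "p = 0 \<and> q = 0")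
      case True
      then show ?thesis by (auto simp: wedge_Nil scale_form_def)
    next
      case False
      then show ?thesis using Nil by (auto simp: wedge_Nil homogeneous_def scale_form_def)
    qed
  next
    case (Cons v vs)
    have 1: "(interior_prod v \<alpha> \<^bold>\<and> \<beta>) vs
        = (-1) ^ (p * q) * (-1) ^ q * (\<beta> \<^bold>\<and> interior_prod v \<alpha>) vs"
    proof (cases p)
      case 0
      then show ?thesis using Cons.prems by (simp add: interior_prod_homogeneous_0)
    next
      case (Suc p')
      then show ?thesis
        using Cons.IH[OF homogeneous_interior_prod[of p' \<alpha>] Cons.prems(2)] Cons.prems
        by (simp add: scale_form_def power_add power_mult_distrib flip: power_mult power2_eq_square)
    qed
    have 2: "(-1) ^ p * (\<alpha> \<^bold>\<and> interior_prod v \<beta>) vs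
        = (-1) ^ (p * q) * (interior_prod v \<beta> \<^bold>\<and> \<alpha>) vs"
    proof (cases q)
      case 0
      then show ?thesis using Cons.prems by (simp add: interior_prod_homogeneous_0)
    next
      case (Suc q')
      then show ?thesis
        using Cons.IH[OF Cons.prems(1) homogeneous_interior_prod[of q' \<beta>]] Cons.prems
        by (simp add: scale_form_def power_add power_mult_distrib flip: power_mult power2_eq_square)
    qed
    show ?case
      using 1 2 Cons.prems
      by (simp add: scale_form_def[of _ "_ \<^bold>\<and> _"] wedge_Cons grade_invol_homogeneous wedge_scale_left
          algebra_simps)
  qed
qed

section \<open>One-forms and the volume form\<close>
lemma wedge_anticommute:
  assumes "homogeneous 1 \<mu>" "homogeneous 1 \<nu>"
  shows "\<mu> \<^bold>\<and> \<nu> = - (\<nu> \<^bold>\<and> \<mu>)"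
  using wedge_commute[OF assms] by (auto simp: scale_form_def fun_eq_iff)

lemma wedge_self:
  assumes "homogeneous 1 \<mu>"
  shows "\<mu> \<^bold>\<and> \<mu> = 0"
  using wedge_anticommute[OF assms assms] by (simp add: fun_eq_iff)

lemma wedge_commute_even:
  assumes "homogeneous 2 \<alpha>" "homogeneous q \<beta>"
  shows "\<alpha> \<^bold>\<and> \<beta> = \<beta> \<^bold>\<and> \<alpha>"
  using wedge_commute[OF assms] by (simp add: scale_form_def)

definition unit_form :: form
  where "unit_form = (\<lambda>vs. if vs = [] then 1 else 0)"

lemma unit_form_wedge: "unit_form \<^bold>\<and> \<beta> = \<beta>"
proof
  have *: "interior_prod v unit_form = 0" "grade_invol unit_form = unit_form" for v
    by (auto simp: interior_prod_def unit_form_def grade_invol_def fun_eq_iff)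
  show "(unit_form \<^bold>\<and> \<beta>) vs = \<beta> vs" for vs
  proof (induction vs arbitrary: \<beta>)
    case Nil
    show ?case by (simp add: wedge_Nil unit_form_def)
  next
    case (Cons v vs)
    then show ?case by (simp add: wedge_Cons *) (simp add: interior_prod_def)
  qed
qed

text \<open>
  For \<open>s = -\<i>\<close> this is twice the contraction with the \<open>(1,0)\<close>-part of \<open>v\<close>, which annihilates
  \<open>(0,1)\<close>-forms; for \<open>s = \<i>\<close> it is twice the contraction with the \<open>(0,1)\<close>-part, which annihilates
  \<open>(1,0)\<close>-forms.
\<close>

definition contract :: "complex \<Rightarrow> complex^4 \<Rightarrow> form \<Rightarrow> form"
  where "contract s v \<alpha> = interior_prod v \<alpha> + s *\<^sub>C interior_prod (\<i> *s v) \<alpha>"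

lemma contract_zero: "contract s v 0 = 0"
  by (simp add: contract_def interior_prod_def scale_form_def fun_eq_iff)

lemma contract_wedge:
  "contract s v (\<alpha> \<^bold>\<and> \<beta>) = contract s v \<alpha> \<^bold>\<and> \<beta> + grade_invol \<alpha> \<^bold>\<and> contract s v \<beta>"
  by (simp add: contract_def interior_prod_wedge wedge_add_left wedge_add_right
      wedge_scale_left wedge_scale_right forms.scale_right_distrib)

lemma contract_wedge_eq_0:
  assumes "contract s v \<alpha> = 0" "contract s v \<beta> = 0"
  shows "contract s v (\<alpha> \<^bold>\<and> \<beta>) = 0"
  using assms by (simp add: contract_wedge)

text \<open>
  Contracting \<open>\<mu> \<and> \<beta> = 0\<close> leaves \<open>c \<beta> = 0\<close>. This strips one factor at a time from a product that
  is supposed to vanish.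
\<close>

lemma wedge_eq_0_cancel:
  assumes "contract s v \<mu> = c *\<^sub>C unit_form" "c \<noteq> 0" "contract s v \<beta> = 0" "\<mu> \<^bold>\<and> \<beta> = 0"
  shows "\<beta> = 0"
proof -
  have "c *\<^sub>C \<beta> = contract s v (\<mu> \<^bold>\<and> \<beta>)"
    using assms(1,3) by (simp add: contract_wedge wedge_scale_left unit_form_wedge)
  then show ?thesis
    using assms(2,4) by (simp add: contract_zero)
qed

lemma contract_form_of_functional:
  "contract s v (form_of_functional f) = (f v + s * f (\<i> *s v)) *\<^sub>C unit_form"
  by (auto simp: contract_def interior_prod_def form_of_functional_def unit_form_def
      scale_form_def fun_eq_iff)

lemma homogeneous_form_of_functional: "homogeneous 1 (form_of_functional f)"
  by (simp add: homogeneous_def form_of_functional_def)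

lemma Lambda_1_0_homogeneous: "\<mu> \<in> Lambda_1_0 \<Longrightarrow> homogeneous 1 \<mu>"
  using homogeneous_form_of_functional by (auto simp: Lambda_1_0_def)

lemma homogeneous_conj_form: "homogeneous p \<alpha> \<Longrightarrow> homogeneous p (conj_form \<alpha>)"
  by (simp add: homogeneous_def conj_form_def)

lemma homogeneous_scale: "homogeneous p \<alpha> \<Longrightarrow> homogeneous p (c *\<^sub>C \<alpha>)"
  by (simp add: homogeneous_def scale_form_def)

lemma homogeneous_uminus: "homogeneous p \<alpha> \<Longrightarrow> homogeneous p (- \<alpha>)"
  by (simp add: homogeneous_def)

lemma homogeneous_sum: "(\<And>i. i \<in> I \<Longrightarrow> homogeneous p (f i)) \<Longrightarrow> homogeneous p (\<Sum>i\<in>I. f i)"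
  by (induction I rule: infinite_finite_induct) (auto simp: homogeneous_def)

lemma contract_Lambda_1_0:
  assumes "\<mu> \<in> Lambda_1_0"
  shows "contract (- \<i>) v \<mu> = (2 * \<mu> [v]) *\<^sub>C unit_form"
    and "contract (- \<i>) v (conj_form \<mu>) = 0"
    and "contract \<i> v \<mu> = 0"
    and "contract \<i> v (conj_form \<mu>) = (2 * cnj (\<mu> [v])) *\<^sub>C unit_form"
proof -
  obtain f where f: "\<mu> = form_of_functional f" "Vector_Spaces.linear (*s) (*) f"
    using assms by (auto simp: Lambda_1_0_def)
  have "f (\<i> *s v) = \<i> * f v"
    using f(2) by (simp add: Vector_Spaces.linear_iff)
  moreover have "conj_form \<mu> = form_of_functional (\<lambda>v. cnj (f v))"
    by (simp add: f(1) conj_form_def form_of_functional_def fun_eq_iff)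
  moreover have "\<mu> [v] = f v"
    by (simp add: f(1) form_of_functional_def)
  ultimately show "contract (- \<i>) v \<mu> = (2 * \<mu> [v]) *\<^sub>C unit_form"
    and "contract (- \<i>) v (conj_form \<mu>) = 0"
    and "contract \<i> v \<mu> = 0"
    and "contract \<i> v (conj_form \<mu>) = (2 * cnj (\<mu> [v])) *\<^sub>C unit_form"
    by (simp_all add: f(1) contract_form_of_functional)
qed

lemma atLeastAtMost_1_4: "{1..4::nat} = {1, 2, 3, 4}"
  by auto

lemma sum_1_4: "(\<Sum>i=1..4. f i) = f 1 + f 2 + f 3 + f (4::nat)"
  for f :: "nat \<Rightarrow> 'a :: comm_monoid_add"
  unfolding atLeastAtMost_1_4 by (simp add: add.assoc)

lemma atLeastAtMost_1_6: "{1..6::nat} = {1, 2, 3, 4, 5, 6}"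
  by auto

lemma sum_1_6: "(\<Sum>i=1..6. f i) = f 1 + f 2 + f 3 + f 4 + f 5 + f (6::nat)"
  for f :: "nat \<Rightarrow> 'a :: comm_monoid_add"
  unfolding atLeastAtMost_1_6 by (simp add: add.assoc)

locale coframe =
  fixes \<omega> :: "nat \<Rightarrow> form"
  assumes basis: "basis_1_0 \<omega>"
begin

lemma coframe_Lambda_1_0: "1 \<le> i \<Longrightarrow> i \<le> 4 \<Longrightarrow> \<omega> i \<in> Lambda_1_0"
  using basis forms.span_base[of "\<omega> i" "\<omega> ` {1..4}"] by (auto simp: basis_1_0_def)

lemma coframe_homogeneous: "1 \<le> i \<Longrightarrow> i \<le> 4 \<Longrightarrow> homogeneous 1 (\<omega> i)"
  by (intro Lambda_1_0_homogeneous coframe_Lambda_1_0)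

lemma Lambda_1_0_expansion:
  assumes "\<mu> \<in> Lambda_1_0"
  obtains c where "\<mu> = (\<Sum>i=1..4. c i *\<^sub>C \<omega> i)"
proof -
  have "\<mu> \<in> range (\<lambda>u. \<Sum>v\<in>\<omega> ` {1..4}. u v *\<^sub>C v)"
    using assms basis forms.span_finite[of "\<omega> ` {1..4}"] by (simp add: basis_1_0_def)
  then obtain u where "\<mu> = (\<Sum>v\<in>\<omega> ` {1..4}. u v *\<^sub>C v)"
    by auto
  also have "\<dots> = (\<Sum>i=1..4. u (\<omega> i) *\<^sub>C \<omega> i)"
    using basis by (subst sum.reindex) (auto simp: basis_1_0_def)
  finally show thesis by (rule that)
qed

lemma Lambda_1_0_combination: "(\<Sum>i=1..4. c i *\<^sub>C \<omega> i) \<in> Lambda_1_0"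
proof -
  have "(\<Sum>i=1..4. c i *\<^sub>C \<omega> i) \<in> forms.span (\<omega> ` {1..4})"
    by (intro forms.span_sum forms.span_scale forms.span_base) auto
  then show ?thesis
    using basis by (simp add: basis_1_0_def)
qed

text \<open>
  The forms \<open>\<omega>\<^sup>i\<close> span all complex linear functionals, in particular the coordinates, so the linear map
  with components \<open>\<omega>\<^sup>i\<close> is an injective endomorphism of \<open>\<complex>\<^sup>4\<close>, hence onto.
\<close>

lemma dual_frame:
  obtains e where "\<forall>i\<in>{1..4}. \<forall>j\<in>{1..4}. \<omega> i [e j] = (if i = j then 1 else 0)"
proof -
  have "\<exists>f. \<omega> i = form_of_functional f \<and> Vector_Spaces.linear (*s) (*) f" if "i \<in> {1..4}" for i
    using coframe_Lambda_1_0[of i] that by (auto simp: Lambda_1_0_def)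
  then obtain f where f: "\<And>i. i \<in> {1..4} \<Longrightarrow> \<omega> i = form_of_functional (f i)"
      "\<And>i. i \<in> {1..4} \<Longrightarrow> Vector_Spaces.linear (*s) (*) (f i)"
    by metis
  have eval: "\<omega> i [v] = f i v" if "i \<in> {1..4}" for i v
    using f(1)[OF that] by (simp add: form_of_functional_def)
  obtain g :: "4 \<Rightarrow> nat" where g: "bij_betw g UNIV {1..4}"
    using finite_same_card_bij[of "UNIV :: 4 set" "{1..4::nat}"] by auto
  have g_in: "g k \<in> {1..4}" for k
    using g by (auto simp: bij_betw_def)
  have g_surj: "\<exists>k. i = g k" if "i \<in> {1..4}" for i
    using that unfolding bij_betw_imp_surj_on[OF g, symmetric] by blast
  define F :: "complex^4 \<Rightarrow> complex^4" where "F v = (\<chi> k. f (g k) v)" for v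
  have lin: "Vector_Spaces.linear (*s) (*s) F"
    using f(2)[OF g_in] by (simp add: Vector_Spaces.linear_iff F_def vec_eq_iff vec.vector_space_axioms)
  have "inj F"
  proof (rule vec.linear_inj_iff_eq_0[OF lin, THEN iffD2], intro allI impI)
    fix v assume "F v = 0"
    have "f i v = 0" if "i \<in> {1..4}" for i
    proof -
      obtain k where "i = g k"
        using g_surj[OF \<open>i \<in> {1..4}\<close>] by blast
      then show ?thesis
        using \<open>F v = 0\<close> by (simp add: F_def vec_eq_iff)
    qed
    then have van: "\<mu> [v] = 0" if "\<mu> \<in> Lambda_1_0" for \<mu>
    proof -
      obtain c where "\<mu> = (\<Sum>i=1..4. c i *\<^sub>C \<omega> i)"
        using \<open>\<mu> \<in> Lambda_1_0\<close> by (rule Lambda_1_0_expansion)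
      then show ?thesis
        unfolding sum_1_4 using eval \<open>\<And>i. i \<in> {1..4} \<Longrightarrow> f i v = 0\<close>
        by (simp add: scale_form_def)
    qed
    have "v $ k = 0" for k
    proof -
      have "Vector_Spaces.linear (*s) (*) (\<lambda>v::complex^4. v $ k)"
        by (simp add: Vector_Spaces.linear_iff vec.vector_space_axioms vector_space_over_itself.vector_space_axioms)
      then have "form_of_functional (\<lambda>v. v $ k) \<in> Lambda_1_0"
        by (auto simp: Lambda_1_0_def)
      from van[OF this] show ?thesis
        by (simp add: form_of_functional_def)
    qed
    then show "v = 0"
      by (simp add: vec_eq_iff)
  qed
  then have "surj F"
    by (rule vec.linear_inj_imp_surj[OF lin])
  define e where "e j = inv F (\<chi> k. if g k = j then 1 else 0)" for j
  have "f i (e j) = (if i = j then 1 else 0)" if i: "i \<in> {1..4}" for i j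
  proof -
    obtain k where k: "i = g k"
      using g_surj[OF i] by blast
    have "F (e j) $ k = (if g k = j then 1 else 0)"
      unfolding e_def using \<open>surj F\<close> by (simp add: surj_f_inv_f)
    then show ?thesis
      by (simp add: F_def k)
  qed
  then show thesis
    using eval by (intro that[of e]) simp
qed

definition top_form :: form
  where "top_form = \<omega> 1 \<^bold>\<and> (\<omega> 2 \<^bold>\<and> (\<omega> 3 \<^bold>\<and> \<omega> 4))"

lemma Vol_eq: "Vol \<omega> = top_form \<^bold>\<and> conj_form top_form"
  by (simp add: Vol_def top_form_def conj_form_wedge wedge_assoc)

text \<open>
  The \<open>(1,0)\<close>-contractions with a dual frame remove \<open>\<omega>\<^sup>1, \<dots>, \<omega>\<^sup>4\<close> in turn, and the
  \<open>(0,1)\<close>-contractions then remove their conjugates, until a non-zero constant is left.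
\<close>

lemma Vol_nonzero: "Vol \<omega> \<noteq> 0"
proof
  assume "Vol \<omega> = 0"
  obtain e where e: "\<forall>i\<in>{1..4}. \<forall>j\<in>{1..4}. \<omega> i [e j] = (if i = j then 1 else 0)"
    by (rule dual_frame)
  have holo: "contract (- \<i>) (e j) (\<omega> i) = (if i = j then 2 else 0) *\<^sub>C unit_form"
      "contract (- \<i>) (e j) (conj_form (\<omega> i)) = 0"
      "contract \<i> (e j) (conj_form (\<omega> i)) = (if i = j then 2 else 0) *\<^sub>C unit_form"
    if "i \<in> {1..4}" "j \<in> {1..4}" for i j
    using that contract_Lambda_1_0[OF coframe_Lambda_1_0[of i], of "e j"] e by auto
  have cancel: "\<beta> = 0"
    if "i \<in> {1..4}" "contract (- \<i>) (e i) \<beta> = 0" "\<omega> i \<^bold>\<and> \<beta> = 0" for i \<beta>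
    using wedge_eq_0_cancel[OF holo(1)[of i i]] that by simp
  have cancel': "\<beta> = 0"
    if "i \<in> {1..4}" "contract \<i> (e i) \<beta> = 0" "conj_form (\<omega> i) \<^bold>\<and> \<beta> = 0" for i \<beta>
    using wedge_eq_0_cancel[OF holo(3)[of i i]] that by simp
  note \<open>Vol \<omega> = 0\<close>[unfolded Vol_def wedge_assoc]
  then have "\<omega> 2 \<^bold>\<and> (\<omega> 3 \<^bold>\<and> (\<omega> 4 \<^bold>\<and> (conj_form (\<omega> 1) \<^bold>\<and> (conj_form (\<omega> 2) \<^bold>\<and> (conj_form (\<omega> 3) \<^bold>\<and> conj_form (\<omega> 4)))))) = 0"
    by (rule cancel[of 1, rotated 2]) (auto intro!: contract_wedge_eq_0 simp: holo)
  then have "\<omega> 3 \<^bold>\<and> (\<omega> 4 \<^bold>\<and> (conj_form (\<omega> 1) \<^bold>\<and> (conj_form (\<omega> 2) \<^bold>\<and> (conj_form (\<omega> 3) \<^bold>\<and> conj_form (\<omega> 4))))) = 0"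
    by (rule cancel[of 2, rotated 2]) (auto intro!: contract_wedge_eq_0 simp: holo)
  then have "\<omega> 4 \<^bold>\<and> (conj_form (\<omega> 1) \<^bold>\<and> (conj_form (\<omega> 2) \<^bold>\<and> (conj_form (\<omega> 3) \<^bold>\<and> conj_form (\<omega> 4)))) = 0"
    by (rule cancel[of 3, rotated 2]) (auto intro!: contract_wedge_eq_0 simp: holo)
  then have "conj_form (\<omega> 1) \<^bold>\<and> (conj_form (\<omega> 2) \<^bold>\<and> (conj_form (\<omega> 3) \<^bold>\<and> conj_form (\<omega> 4))) = 0"
    by (rule cancel[of 4, rotated 2]) (auto intro!: contract_wedge_eq_0 simp: holo)
  then have "conj_form (\<omega> 2) \<^bold>\<and> (conj_form (\<omega> 3) \<^bold>\<and> conj_form (\<omega> 4)) = 0"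
    by (rule cancel'[of 1, rotated 2]) (auto intro!: contract_wedge_eq_0 simp: holo)
  then have "conj_form (\<omega> 3) \<^bold>\<and> conj_form (\<omega> 4) = 0"
    by (rule cancel'[of 2, rotated 2]) (auto intro!: contract_wedge_eq_0 simp: holo)
  then have "conj_form (\<omega> 4) = 0"
    by (rule cancel'[of 3, rotated 2]) (auto intro!: contract_wedge_eq_0 simp: holo)
  then have "2 *\<^sub>C unit_form = 0"
    using holo(3)[of 4 4] by (simp add: contract_zero)
  then have "(2 *\<^sub>C unit_form) [] = 0"
    by simp
  then show False
    by (simp add: scale_form_def unit_form_def)
qed

end

section \<open>Coordinates on (2,0)-forms and (2,2)-forms\<close>
text \<open>
  The \<open>2 \<times> 2\<close> minors of the matrix with rows \<open>a\<close> and \<open>b\<close>, in the order and with the signs of the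
  \<open>\<phi>\<^sup>l\<close>.
\<close>

definition plucker_coord :: "(nat \<Rightarrow> complex) \<Rightarrow> (nat \<Rightarrow> complex) \<Rightarrow> nat \<Rightarrow> complex"
  where "plucker_coord a b l =
    (if l = 1 then a 1 * b 2 - a 2 * b 1
     else if l = 2 then a 1 * b 3 - a 3 * b 1
     else if l = 3 then a 1 * b 4 - a 4 * b 1
     else if l = 4 then a 2 * b 3 - a 3 * b 2
     else if l = 5 then a 4 * b 2 - a 2 * b 4
     else a 3 * b 4 - a 4 * b 3)"

lemma ball_1_6: "(\<forall>l\<in>{1..6::nat}. P l) \<longleftrightarrow> P 1 \<and> P 2 \<and> P 3 \<and> P 4 \<and> P 5 \<and> P 6"
  unfolding atLeastAtMost_1_6 by simp

text \<open>
  When one of the first four minors is non-zero, the two rows are taken in echelon form with respect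
  to the corresponding columns; the quadratic relation takes care of the complementary minor. When
  all four vanish, the form is \<open>\<mu> \<and> \<omega>\<^sup>4\<close> for a combination \<open>\<mu>\<close> of \<open>\<omega>\<^sup>2\<close> and \<open>\<omega>\<^sup>3\<close>.
\<close>

lemma plucker_surj:
  assumes "x 1 * x 6 + x 2 * x 5 + x 3 * x 4 = 0"
  shows "\<exists>a b. \<forall>l\<in>{1..6}. plucker_coord a b l = x l"
proof -
  have factor: ?thesis
    if "p * t - q * s = x 1" "p * u - r * s = x 2" "p * v - w * s = x 3"
      "q * u - r * t = x 4" "w * t - q * v = x 5" "r * v - w * u = x 6"
    for p q r w s t u v
    unfolding ball_1_6
    by (rule exI[of _ "\<lambda>i. if i = 1 then p else if i = 2 then q else if i = 3 then r else w"],
        rule exI[of _ "\<lambda>i. if i = 1 then s else if i = 2 then t else if i = 3 then u else v"])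
      (use that in \<open>simp add: plucker_coord_def\<close>)
  consider "x 1 \<noteq> 0" | "x 2 \<noteq> 0" | "x 3 \<noteq> 0" | "x 1 = 0" "x 2 = 0" "x 3 = 0" "x 4 \<noteq> 0"
    | "x 1 = 0" "x 2 = 0" "x 3 = 0" "x 4 = 0"
    by blast
  then show ?thesis
  proof cases
    case 1
    have "x 1 * x 6 = - (x 2 * x 5 + x 3 * x 4)"
      using assms by algebra
    with 1 have *: "x 6 = - (x 2 * x 5 + x 3 * x 4) / x 1"
      by (simp add: nonzero_eq_divide_eq mult.commute)
    then show ?thesis
      using 1 by (intro factor[where p = 1 and q = 0 and r = "- x 4 / x 1" and w = "x 5 / x 1"
            and s = 0 and t = "x 1" and u = "x 2" and v = "x 3"])
        (simp_all add: * field_simps)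
  next
    case 2
    have "x 2 * x 5 = - (x 1 * x 6 + x 3 * x 4)"
      using assms by algebra
    with 2 have *: "x 5 = - (x 1 * x 6 + x 3 * x 4) / x 2"
      by (simp add: nonzero_eq_divide_eq mult.commute)
    then show ?thesis
      using 2 by (intro factor[where p = 1 and q = "x 4 / x 2" and r = 0 and w = "- x 6 / x 2"
            and s = 0 and t = "x 1" and u = "x 2" and v = "x 3"])
        (simp_all add: * field_simps)
  next
    case 3
    have "x 3 * x 4 = - (x 1 * x 6 + x 2 * x 5)"
      using assms by algebra
    with 3 have *: "x 4 = - (x 1 * x 6 + x 2 * x 5) / x 3"
      by (simp add: nonzero_eq_divide_eq mult.commute)
    then show ?thesis
      using 3 by (intro factor[where p = 1 and q = "- x 5 / x 3" and r = "x 6 / x 3" and w = 0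
            and s = 0 and t = "x 1" and u = "x 2" and v = "x 3"])
        (simp_all add: * field_simps)
  next
    case 4
    then show ?thesis
      by (intro factor[where p = 0 and q = 1 and r = 0 and w = "- x 6 / x 4"
            and s = 0 and t = 0 and u = "x 4" and v = "- x 5"]) simp_all
  next
    case 5
    then show ?thesis
      by (intro factor[where p = 0 and q = "- x 5" and r = "x 6" and w = 0
            and s = 0 and t = 0 and u = 0 and v = 1]) simp_all
  qed
qed

definition hermitian_mat :: "(nat \<Rightarrow> nat \<Rightarrow> complex) \<Rightarrow> bool"
  where "hermitian_mat h \<longleftrightarrow> (\<forall>l m. h l m = cnj (h m l))"

context coframe
begin

lemma coframe_swap:
  assumes "1 \<le> i" "i < j" "j \<le> 4"
  shows "\<omega> j \<^bold>\<and> \<omega> i = - (\<omega> i \<^bold>\<and> \<omega> j)"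
    and "\<omega> j \<^bold>\<and> (\<omega> i \<^bold>\<and> \<beta>) = - (\<omega> i \<^bold>\<and> (\<omega> j \<^bold>\<and> \<beta>))"
proof -
  show *: "\<omega> j \<^bold>\<and> \<omega> i = - (\<omega> i \<^bold>\<and> \<omega> j)"
    using assms by (intro wedge_anticommute coframe_homogeneous) auto
  show "\<omega> j \<^bold>\<and> (\<omega> i \<^bold>\<and> \<beta>) = - (\<omega> i \<^bold>\<and> (\<omega> j \<^bold>\<and> \<beta>))"
    using * by (simp add: wedge_minus_left flip: wedge_assoc)
qed

lemma coframe_square:
  assumes "1 \<le> i" "i \<le> 4"
  shows "\<omega> i \<^bold>\<and> \<omega> i = 0" and "\<omega> i \<^bold>\<and> (\<omega> i \<^bold>\<and> \<beta>) = 0"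
proof -
  show *: "\<omega> i \<^bold>\<and> \<omega> i = 0"
    using assms by (intro wedge_self coframe_homogeneous)
  show "\<omega> i \<^bold>\<and> (\<omega> i \<^bold>\<and> \<beta>) = 0"
    by (simp add: * flip: wedge_assoc)
qed

lemma phi_homogeneous: "homogeneous 2 (phi \<omega> l)"
proof -
  have "homogeneous 2 (\<omega> i \<^bold>\<and> \<omega> j)" if "1 \<le> i" "i \<le> 4" "1 \<le> j" "j \<le> 4" for i j
    using homogeneous_wedge[OF coframe_homogeneous coframe_homogeneous, of i j] that
    by (simp add: numeral_2_eq_2)
  moreover have "homogeneous 2 0"
    by (simp add: homogeneous_def)
  ultimately show ?thesis
    by (simp add: phi_def homogeneous_uminus)
qed

text \<open>
  The pairing \<open>\<Lambda>\<^sup>2\<^sup>,\<^sup>0 \<times> \<Lambda>\<^sup>2\<^sup>,\<^sup>0 \<rightarrow> \<Lambda>\<^sup>4\<^sup>,\<^sup>0\<close> in the basis \<open>\<phi>\<^sup>l\<close>; the sign in \<open>\<phi>\<^sup>5\<close> makes all three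
  complementary products equal.
\<close>

lemma phi_wedge_phi:
  assumes "l \<in> {1..6}" "m \<in> {1..6}"
  shows "phi \<omega> l \<^bold>\<and> phi \<omega> m = (if l + m = 7 then top_form else 0)"
  using assms unfolding atLeastAtMost_1_6
  by (elim insertE emptyE; simp add: phi_def top_form_def wedge_assoc coframe_swap coframe_square
      wedge_minus_left wedge_minus_right)

definition plucker_form :: "(nat \<Rightarrow> complex) \<Rightarrow> form"
  where "plucker_form x = (\<Sum>l=1..6. x l *\<^sub>C phi \<omega> l)"

lemma plucker_form_cong: "(\<And>l. l \<in> {1..6} \<Longrightarrow> x l = y l) \<Longrightarrow> plucker_form x = plucker_form y"
  by (simp add: plucker_form_def)

lemma plucker_form_homogeneous: "homogeneous 2 (plucker_form x)"
  unfolding plucker_form_def by (intro homogeneous_sum homogeneous_scale phi_homogeneous)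

lemma wedge_eq_plucker_form:
  "(\<Sum>i=1..4. a i *\<^sub>C \<omega> i) \<^bold>\<and> (\<Sum>i=1..4. b i *\<^sub>C \<omega> i) = plucker_form (plucker_coord a b)"
proof -
  have "(\<Sum>i=1..4. a i *\<^sub>C \<omega> i) \<^bold>\<and> (\<Sum>i=1..4. b i *\<^sub>C \<omega> i)
      = (a 1 * b 2 - a 2 * b 1) *\<^sub>C (\<omega> 1 \<^bold>\<and> \<omega> 2) + (a 1 * b 3 - a 3 * b 1) *\<^sub>C (\<omega> 1 \<^bold>\<and> \<omega> 3)
      + (a 1 * b 4 - a 4 * b 1) *\<^sub>C (\<omega> 1 \<^bold>\<and> \<omega> 4) + (a 2 * b 3 - a 3 * b 2) *\<^sub>C (\<omega> 2 \<^bold>\<and> \<omega> 3)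
      + (a 2 * b 4 - a 4 * b 2) *\<^sub>C (\<omega> 2 \<^bold>\<and> \<omega> 4) + (a 3 * b 4 - a 4 * b 3) *\<^sub>C (\<omega> 3 \<^bold>\<and> \<omega> 4)"
    unfolding sum_1_4 wedge_add_left wedge_add_right wedge_scale_left wedge_scale_right
    by (simp add: coframe_swap coframe_square)
      (simp add: scale_form_def fun_eq_iff algebra_simps)
  also have "\<dots> = plucker_form (plucker_coord a b)"
    unfolding plucker_form_def sum_1_6
    by (simp add: plucker_coord_def phi_def) (simp add: scale_form_def fun_eq_iff algebra_simps)
  finally show ?thesis .
qed

lemma plucker_form_wedge:
  "plucker_form x \<^bold>\<and> plucker_form y = (\<Sum>l=1..6. x l * y (7 - l)) *\<^sub>C top_form"
proof -
  have "phi \<omega> l \<^bold>\<and> plucker_form y = y (7 - l) *\<^sub>C top_form" if l: "l \<in> {1..6}" for l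
  proof -
    have "phi \<omega> l \<^bold>\<and> plucker_form y = (\<Sum>m=1..6. y m *\<^sub>C (phi \<omega> l \<^bold>\<and> phi \<omega> m))"
      by (simp only: plucker_form_def wedge_sum_right wedge_scale_right)
    also have "\<dots> = (\<Sum>m=1..6. if m = 7 - l then y m *\<^sub>C top_form else 0)"
      using l by (intro sum.cong) (auto simp: phi_wedge_phi)
    also have "\<dots> = y (7 - l) *\<^sub>C top_form"
      using l by auto
    finally show ?thesis .
  qed
  then show ?thesis
    by (simp add: plucker_form_def[of x] wedge_sum_left wedge_scale_left forms.scale_sum_left)
qed

lemma top_form_nonzero: "top_form \<noteq> 0"
  using Vol_nonzero by (auto simp: Vol_eq)

lemma decomposable_imp_plucker_form:
  assumes "\<psi> \<in> decomposable_2_0"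
  obtains x where "\<psi> = plucker_form x" "x 1 * x 6 + x 2 * x 5 + x 3 * x 4 = 0"
proof -
  obtain \<mu> \<nu> where \<psi>: "\<psi> = \<mu> \<^bold>\<and> \<nu>" "\<mu> \<in> Lambda_1_0" "\<nu> \<in> Lambda_1_0"
    using assms by (auto simp: decomposable_2_0_def)
  obtain a where "\<mu> = (\<Sum>i=1..4. a i *\<^sub>C \<omega> i)"
    using \<psi>(2) by (rule Lambda_1_0_expansion)
  moreover obtain b where "\<nu> = (\<Sum>i=1..4. b i *\<^sub>C \<omega> i)"
    using \<psi>(3) by (rule Lambda_1_0_expansion)
  ultimately have "\<psi> = plucker_form (plucker_coord a b)"
    by (simp only: \<psi>(1) wedge_eq_plucker_form)
  moreover have "plucker_coord a b 1 * plucker_coord a b 6 + plucker_coord a b 2 * plucker_coord a b 5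
      + plucker_coord a b 3 * plucker_coord a b 4 = 0"
    by (simp add: plucker_coord_def algebra_simps)
  ultimately show thesis
    by (rule that)
qed

lemma plucker_form_decomposable:
  assumes "x 1 * x 6 + x 2 * x 5 + x 3 * x 4 = 0"
  shows "plucker_form x \<in> decomposable_2_0"
proof -
  obtain a b where "\<forall>l\<in>{1..6}. plucker_coord a b l = x l"
    using plucker_surj[OF assms] by blast
  then have "plucker_form x = (\<Sum>i=1..4. a i *\<^sub>C \<omega> i) \<^bold>\<and> (\<Sum>i=1..4. b i *\<^sub>C \<omega> i)"
    unfolding wedge_eq_plucker_form by (intro plucker_form_cong) simp
  then show ?thesis
    using Lambda_1_0_combination unfolding decomposable_2_0_def by blast
qed

lemma plucker_form_add: "plucker_form x + plucker_form y = plucker_form (\<lambda>l. x l + y l)"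
  by (simp add: plucker_form_def forms.scale_left_distrib sum.distrib)

lemma plucker_form_scale: "c *\<^sub>C plucker_form x = plucker_form (\<lambda>l. c * x l)"
  by (simp add: plucker_form_def forms.scale_sum_right)

lemma phi_eq_plucker_form:
  assumes "l \<in> {1..6}"
  shows "phi \<omega> l = plucker_form (\<lambda>m. if m = l then 1 else 0)"
  using assms by (simp add: plucker_form_def if_distrib[of "\<lambda>c. c *\<^sub>C _"] cong: if_cong)

lemma phi_decomposable:
  assumes "l \<in> {1..6}"
  shows "phi \<omega> l \<in> decomposable_2_0"
  unfolding phi_eq_plucker_form[OF assms] by (rule plucker_form_decomposable) auto

lemma Lambda_2_0_eq: "Lambda_2_0 = range plucker_form"
proof
  have "forms.subspace (range plucker_form)"
  proof (rule forms.subspaceI)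
    show "0 \<in> range plucker_form"
      by (rule range_eqI[of _ _ "\<lambda>_. 0"]) (simp add: plucker_form_def)
  qed (auto simp: plucker_form_add plucker_form_scale)
  then show "Lambda_2_0 \<subseteq> range plucker_form"
    unfolding Lambda_2_0_def
    by (rule forms.span_minimal[rotated]) (auto elim: decomposable_imp_plucker_form)
  have "plucker_form x \<in> Lambda_2_0" for x
    unfolding Lambda_2_0_def plucker_form_def
    by (intro forms.span_sum forms.span_scale forms.span_base phi_decomposable)
  then show "range plucker_form \<subseteq> Lambda_2_0"
    by blast
qed

definition herm_form :: "(nat \<Rightarrow> nat \<Rightarrow> complex) \<Rightarrow> form"
  where "herm_form h = (\<Sum>l=1..6. \<Sum>m=1..6. h l m *\<^sub>C (phi \<omega> l \<^bold>\<and> conj_form (phi \<omega> m)))"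

lemma herm_form_cong:
  "(\<And>l m. l \<in> {1..6} \<Longrightarrow> m \<in> {1..6} \<Longrightarrow> h l m = k l m) \<Longrightarrow> herm_form h = herm_form k"
  by (simp add: herm_form_def)

lemma herm_form_add: "herm_form h + herm_form k = herm_form (\<lambda>l m. h l m + k l m)"
  by (simp add: herm_form_def forms.scale_left_distrib sum.distrib)

lemma herm_form_scale: "c *\<^sub>C herm_form h = herm_form (\<lambda>l m. c * h l m)"
  by (simp add: herm_form_def forms.scale_sum_right)

lemma herm_form_zero: "herm_form (\<lambda>l m. 0) = 0"
  by (simp add: herm_form_def)

lemma plucker_form_wedge_conj:
  "plucker_form x \<^bold>\<and> conj_form (plucker_form y) = herm_form (\<lambda>l m. x l * cnj (y m))"
  unfolding plucker_form_def herm_form_def conj_form_sum conj_form_scale wedge_sum_left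
  unfolding wedge_sum_right wedge_scale_left wedge_scale_right forms.scale_scale
  by (simp add: mult.commute)

lemma conj_herm_form: "conj_form (herm_form h) = herm_form (\<lambda>l m. cnj (h m l))"
proof -
  have "conj_form (phi \<omega> l) \<^bold>\<and> phi \<omega> m = phi \<omega> m \<^bold>\<and> conj_form (phi \<omega> l)" for l m
    by (rule wedge_commute_even[OF homogeneous_conj_form[OF phi_homogeneous] phi_homogeneous])
  then show ?thesis
    unfolding herm_form_def conj_form_sum conj_form_scale conj_form_wedge
    by (subst sum.swap) simp
qed

lemma Lambda_2_2_eq: "Lambda_2_2 = range herm_form"
proof
  have "forms.subspace (range herm_form)"
  proof (rule forms.subspaceI)
    show "0 \<in> range herm_form"
      by (rule range_eqI[of _ _ "\<lambda>_ _. 0"]) (simp add: herm_form_zero)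
  qed (auto simp: herm_form_add herm_form_scale)
  then show "Lambda_2_2 \<subseteq> range herm_form"
    unfolding Lambda_2_2_def Lambda_2_0_eq
    by (rule forms.span_minimal[rotated]) (auto simp: plucker_form_wedge_conj)
  have phi: "phi \<omega> l \<in> Lambda_2_0" if "l \<in> {1..6}" for l
    using phi_eq_plucker_form[OF that] by (simp add: Lambda_2_0_eq)
  have "herm_form h \<in> Lambda_2_2" for h
    unfolding Lambda_2_2_def herm_form_def
    by (intro forms.span_sum forms.span_scale forms.span_base) (use phi in blast)
  then show "range herm_form \<subseteq> Lambda_2_2"
    by blast
qed

text \<open>
  A form that equals its conjugate is also given by the Hermitian part of any of its coefficient
  matrices.
\<close>

lemma real_Lambda_2_2_iff: "\<Omega> \<in> real_Lambda_2_2 \<longleftrightarrow> (\<exists>h. hermitian_mat h \<and> \<Omega> = herm_form h)"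
proof
  assume "\<Omega> \<in> real_Lambda_2_2"
  then obtain h where h: "\<Omega> = herm_form h" "conj_form \<Omega> = \<Omega>"
    by (auto simp: real_Lambda_2_2_def Lambda_2_2_eq)
  let ?k = "\<lambda>l m. (1/2) * (h l m + cnj (h m l))"
  have "\<Omega> = (1/2) *\<^sub>C (\<Omega> + conj_form \<Omega>)"
    using h(2) by (simp add: scale_form_def fun_eq_iff)
  also have "\<dots> = herm_form ?k"
    unfolding h(1) conj_herm_form herm_form_add herm_form_scale ..
  finally show "\<exists>h. hermitian_mat h \<and> \<Omega> = herm_form h"
    by (intro exI[of _ ?k]) (simp add: hermitian_mat_def add.commute)
next
  assume "\<exists>h. hermitian_mat h \<and> \<Omega> = herm_form h"
  then obtain h where h: "hermitian_mat h" "\<Omega> = herm_form h"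
    by blast
  have "(\<lambda>l m. cnj (h m l)) = h"
    using h(1) by (intro ext) (metis hermitian_mat_def)
  then show "\<Omega> \<in> real_Lambda_2_2"
    by (simp add: real_Lambda_2_2_def Lambda_2_2_eq h(2) conj_herm_form)
qed

text \<open>
  Forms of even degree commute with the other factors, which can therefore be regrouped as
  \<open>(\<phi>\<^sup>l \<and> \<eta>)\<close> times the conjugate of \<open>(\<phi>\<^sup>m \<and> \<theta>)\<close>, each a multiple of the top form.
\<close>

lemma herm_form_wedge:
  "herm_form h \<^bold>\<and> plucker_form x \<^bold>\<and> conj_form (plucker_form y)
    = (\<Sum>l=1..6. \<Sum>m=1..6. h l m * x (7 - l) * cnj (y (7 - m))) *\<^sub>C Vol \<omega>"
proof -
  have "phi \<omega> l \<^bold>\<and> conj_form (phi \<omega> m) \<^bold>\<and> plucker_form x \<^bold>\<and> conj_form (plucker_form y)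
      = (x (7 - l) * cnj (y (7 - m))) *\<^sub>C Vol \<omega>" if "l \<in> {1..6}" "m \<in> {1..6}" for l m
  proof -
    have top: "phi \<omega> l \<^bold>\<and> plucker_form z = z (7 - l) *\<^sub>C top_form" if "l \<in> {1..6}" for l z
      unfolding phi_eq_plucker_form[OF that] plucker_form_wedge
      using that by (simp add: if_distrib[of "\<lambda>c. c * _"] cong: if_cong)
    have "conj_form (phi \<omega> m) \<^bold>\<and> plucker_form x = plucker_form x \<^bold>\<and> conj_form (phi \<omega> m)"
      by (rule wedge_commute_even[OF homogeneous_conj_form[OF phi_homogeneous] plucker_form_homogeneous])
    then have "conj_form (phi \<omega> m) \<^bold>\<and> (plucker_form x \<^bold>\<and> \<beta>)
        = plucker_form x \<^bold>\<and> (conj_form (phi \<omega> m) \<^bold>\<and> \<beta>)" for \<beta>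
      unfolding wedge_assoc[symmetric] by simp
    then have "phi \<omega> l \<^bold>\<and> conj_form (phi \<omega> m) \<^bold>\<and> plucker_form x \<^bold>\<and> conj_form (plucker_form y)
        = (phi \<omega> l \<^bold>\<and> plucker_form x) \<^bold>\<and> conj_form (phi \<omega> m \<^bold>\<and> plucker_form y)"
      by (simp only: wedge_assoc conj_form_wedge)
    then show ?thesis
      using that by (simp add: top conj_form_scale wedge_scale_left wedge_scale_right Vol_eq)
  qed
  then show ?thesis
    by (simp add: herm_form_def wedge_sum_left wedge_scale_left forms.scale_sum_left mult.assoc)
qed

end

section \<open>The quadratic form and its two thresholds\<close>
text \<open>
  The coefficient matrix of \<open>\<Omega>\<^sub>a\<close>. The case \<open>j = k\<close>, in which both corrections fall on the same diagonal
  entry, serves to perturb diagonal entries on the same footing as the others.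
\<close>

definition omega_mat :: "nat \<Rightarrow> nat \<Rightarrow> complex \<Rightarrow> nat \<Rightarrow> nat \<Rightarrow> complex"
  where "omega_mat j k a l m = (if l = m then 1 else 0)
    + (if l = j \<and> m = k then a else 0) + (if l = k \<and> m = j then cnj a else 0)"

lemma omega_mat_hermitian: "hermitian_mat (omega_mat j k a)"
  unfolding hermitian_mat_def
proof (intro allI)
  fix l m
  have "l = m \<longleftrightarrow> m = l" "l = j \<and> m = k \<longleftrightarrow> m = k \<and> l = j" "l = k \<and> m = j \<longleftrightarrow> m = j \<and> l = k"
    by auto
  then show "omega_mat j k a l m = cnj (omega_mat j k a m l)"
    unfolding omega_mat_def by (simp only: complex_cnj_add if_distrib[of cnj] complex_cnj_one
        complex_cnj_zero complex_cnj_cnj ac_simps)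
qed

lemma sum_sum_delta:
  assumes "finite A" "p \<in> A" "q \<in> B" "finite B"
  shows "(\<Sum>l\<in>A. \<Sum>m\<in>B. if l = p \<and> m = q then f l m else 0) = (f p q :: 'a :: comm_monoid_add)"
proof -
  have "(\<Sum>m\<in>B. if l = p \<and> m = q then f l m else 0) = (if l = p then f p q else 0)" for l
    using assms by (cases "l = p") auto
  then show ?thesis
    using assms by simp
qed

lemma two_mult_le_squares: "2 * (x * y) \<le> x\<^sup>2 + y\<^sup>2" for x y :: real
  using sum_squares_bound[of x y] by simp

text \<open>
  The product \<open>z w\<close> is bounded by half of its own two squares and, through the relation, by half of
  the four remaining squares.
\<close>

lemma isotropic_product_bound:
  fixes z w z' w' z'' w'' :: complex
  assumes "z * w + z' * w' + z'' * w'' = 0"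
  shows "4 * (cmod z * cmod w) \<le> (cmod z)\<^sup>2 + (cmod w)\<^sup>2
    + (cmod z')\<^sup>2 + (cmod w')\<^sup>2 + (cmod z'')\<^sup>2 + (cmod w'')\<^sup>2"
proof -
  have "z * w = - (z' * w' + z'' * w'')"
    using assms by algebra
  then have "cmod z * cmod w \<le> cmod z' * cmod w' + cmod z'' * cmod w''"
    using norm_triangle_ineq[of "z' * w'" "z'' * w''"] by (metis norm_minus_cancel norm_mult)
  then show ?thesis
    using two_mult_le_squares[of "cmod z" "cmod w"] two_mult_le_squares[of "cmod z'" "cmod w'"]
      two_mult_le_squares[of "cmod z''" "cmod w''"] by linarith
qed

definition sqnorm :: "(nat \<Rightarrow> complex) \<Rightarrow> real"
  where "sqnorm x = (\<Sum>l=1..6. (cmod (x l))\<^sup>2)"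

text \<open>
  The factor of the volume form in \<open>\<Omega>\<^sub>a \<and> \<eta> \<and> \<eta>\<^sup>*\<close> for \<open>\<eta>\<close> with coordinates \<open>x\<close> (see \<open>Omega_wedge\<close>). The indices in
  \<open>x k\<close> and \<open>x j\<close> are crossed because \<open>\<phi>\<^sup>j\<close> pairs with \<open>\<phi>\<^sup>7\<^sup>-\<^sup>j = \<phi>\<^sup>k\<close>.
\<close>

definition quad :: "nat \<Rightarrow> nat \<Rightarrow> complex \<Rightarrow> (nat \<Rightarrow> complex) \<Rightarrow> real"
  where "quad j k a x = sqnorm x + 2 * Re (a * x k * cnj (x j))"

lemma sqnorm_nonneg: "0 \<le> sqnorm x"
  by (simp add: sqnorm_def sum_nonneg)

lemma sqnorm_eq_0_iff: "sqnorm x = 0 \<longleftrightarrow> (\<forall>l\<in>{1..6}. x l = 0)"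
  by (simp add: sqnorm_def sum_nonneg_eq_0_iff)

text \<open>
  Both thresholds come from the same argument: an estimate of \<open>|x\<^sub>j x\<^sub>k|\<close> on the set \<open>X\<close> of test
  vectors, and a vector in \<open>X\<close> attaining equality with the phase that makes the mixed term negative.
\<close>

lemma quad_criterion:
  assumes bound: "\<And>x. x \<in> X \<Longrightarrow> 2 * \<kappa> * (cmod (x j) * cmod (x k)) \<le> sqnorm x"
    and witness: "a \<noteq> 0 \<Longrightarrow> \<exists>x\<in>X. sqnorm x = 2 * \<kappa> \<and> x k = 1 \<and> x j = - sgn a"
    and "\<kappa> > 0"
  shows "(\<forall>x\<in>X. quad j k a x \<ge> 0) \<longleftrightarrow> cmod a \<le> \<kappa>"
    and "(\<forall>x\<in>X. sqnorm x \<noteq> 0 \<longrightarrow> quad j k a x > 0) \<longleftrightarrow> cmod a < \<kappa>"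
proof -
  have lower: "quad j k a x \<ge> sqnorm x - 2 * cmod a * (cmod (x j) * cmod (x k))" for x
  proof -
    have "\<bar>Re (a * x k * cnj (x j))\<bar> \<le> cmod (a * x k * cnj (x j))"
      by (rule abs_Re_le_cmod)
    also have "\<dots> = cmod a * (cmod (x j) * cmod (x k))"
      by (simp add: norm_mult mult_ac)
    finally show ?thesis
      by (simp add: quad_def)
  qed
  have attained: "\<exists>x\<in>X. sqnorm x \<noteq> 0 \<and> quad j k a x = 2 * \<kappa> - 2 * cmod a" if "a \<noteq> 0"
  proof -
    obtain x where x: "x \<in> X" "sqnorm x = 2 * \<kappa>" "x k = 1" "x j = - sgn a"
      using witness \<open>a \<noteq> 0\<close> by blast
    have "a * cnj a = (complex_of_real (cmod a))\<^sup>2"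
      by (metis complex_norm_square of_real_power)
    then have "a * cnj (sgn a) = cmod a"
      using that by (simp add: sgn_div_norm scaleR_conv_of_real field_simps power2_eq_square)
    then have "quad j k a x = 2 * \<kappa> - 2 * cmod a"
      using x by (simp add: quad_def)
    then show ?thesis
      using x \<open>\<kappa> > 0\<close> by (intro bexI[of _ x]) auto
  qed
  show "(\<forall>x\<in>X. quad j k a x \<ge> 0) \<longleftrightarrow> cmod a \<le> \<kappa>"
  proof
    assume nonneg: "\<forall>x\<in>X. quad j k a x \<ge> 0"
    show "cmod a \<le> \<kappa>"
    proof (cases "a = 0")
      case False
      then obtain x where "x \<in> X" "quad j k a x = 2 * \<kappa> - 2 * cmod a"
        using attained by blast
      then show ?thesis
        using nonneg by fastforce
    qed (use \<open>\<kappa> > 0\<close> in simp)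
  next
    assume le: "cmod a \<le> \<kappa>"
    show "\<forall>x\<in>X. quad j k a x \<ge> 0"
    proof
      fix x assume "x \<in> X"
      have "2 * cmod a * (cmod (x j) * cmod (x k)) \<le> 2 * \<kappa> * (cmod (x j) * cmod (x k))"
        using le by (intro mult_right_mono) auto
      then show "quad j k a x \<ge> 0"
        using bound[OF \<open>x \<in> X\<close>] lower[of x] by linarith
    qed
  qed
  show "(\<forall>x\<in>X. sqnorm x \<noteq> 0 \<longrightarrow> quad j k a x > 0) \<longleftrightarrow> cmod a < \<kappa>"
  proof
    assume pos: "\<forall>x\<in>X. sqnorm x \<noteq> 0 \<longrightarrow> quad j k a x > 0"
    show "cmod a < \<kappa>"
    proof (cases "a = 0")
      case False
      then obtain x where "x \<in> X" "sqnorm x \<noteq> 0" "quad j k a x = 2 * \<kappa> - 2 * cmod a"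
        using attained by blast
      then show ?thesis
        using pos by fastforce
    qed (use \<open>\<kappa> > 0\<close> in simp)
  next
    assume less: "cmod a < \<kappa>"
    show "\<forall>x\<in>X. sqnorm x \<noteq> 0 \<longrightarrow> quad j k a x > 0"
    proof (intro ballI impI)
      fix x assume "x \<in> X" "sqnorm x \<noteq> 0"
      then have "sqnorm x > 0"
        using sqnorm_nonneg[of x] by simp
      define t where "t = cmod (x j) * cmod (x k)"
      have "t \<ge> 0"
        by (simp add: t_def)
      then have "t = 0 \<or> 2 * cmod a * t < 2 * \<kappa> * t"
        using less mult_strict_right_mono[of "2 * cmod a" "2 * \<kappa>" t] by linarith
      then show "quad j k a x > 0"
        using bound[OF \<open>x \<in> X\<close>] lower[of x] \<open>sqnorm x > 0\<close> unfolding t_def[symmetric] by auto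
    qed
  qed
qed

definition klein_quadric :: "(nat \<Rightarrow> complex) set"
  where "klein_quadric = {x. x 1 * x 6 + x 2 * x 5 + x 3 * x 4 = 0}"

lemma complementary_cases:
  assumes "1 \<le> j" "j < k" "k \<le> 6" "j + k = 7"
  obtains "j = 1" "k = 6" | "j = 2" "k = 5" | "j = 3" "k = (4::nat)"
  using assms by force

lemma quad_klein_quadric:
  assumes "1 \<le> j" "j < k" "k \<le> 6" "j + k = 7"
  shows "(\<forall>x\<in>klein_quadric. quad j k a x \<ge> 0) \<longleftrightarrow> cmod a \<le> 2"
    and "(\<forall>x\<in>klein_quadric. sqnorm x \<noteq> 0 \<longrightarrow> quad j k a x > 0) \<longleftrightarrow> cmod a < 2"
proof -
  have bound: "2 * 2 * (cmod (x j) * cmod (x k)) \<le> sqnorm x" if "x \<in> klein_quadric" for x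
  proof -
    have eq: "x 1 * x 6 + x 2 * x 5 + x 3 * x 4 = 0" "x 2 * x 5 + x 1 * x 6 + x 3 * x 4 = 0"
        "x 3 * x 4 + x 1 * x 6 + x 2 * x 5 = 0"
      using that by (simp_all add: klein_quadric_def ac_simps)
    show ?thesis
      using assms
    proof (cases rule: complementary_cases)
      case 1
      show ?thesis unfolding 1 sqnorm_def sum_1_6
        using isotropic_product_bound[OF eq(1)] by linarith
    next
      case 2
      show ?thesis unfolding 2 sqnorm_def sum_1_6
        using isotropic_product_bound[OF eq(2)] by linarith
    next
      case 3
      show ?thesis unfolding 3 sqnorm_def sum_1_6
        using isotropic_product_bound[OF eq(3)] by linarith
    qed
  qed
  have witness: "\<exists>x\<in>klein_quadric. sqnorm x = 2 * 2 \<and> x k = 1 \<and> x j = - sgn a" if "a \<noteq> 0"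
  proof -
    \<comment> \<open>Equality requires \<open>\<bar>x j\<bar> = \<bar>x k\<bar>\<close> and other entries whose products cancel
        \<open>x j * x k = - sgn a\<close>; one further complementary pair \<open>(p, 7 - p)\<close> suffices.\<close>
    define p :: nat where "p = (if j = 1 then 2 else 1)"
    define x where "x i = (if i = j then - sgn a else if i = k then 1
        else if i = p then 1 else if i = 7 - p then sgn a else 0)" for i
    have "cmod (sgn a) = 1"
      using that by (simp add: norm_sgn)
    with assms have "x \<in> klein_quadric \<and> sqnorm x = 2 * 2 \<and> x k = 1 \<and> x j = - sgn a"
      unfolding klein_quadric_def sqnorm_def sum_1_6
      by (cases rule: complementary_cases) (auto simp: x_def p_def)
    then show ?thesis by blast
  qed
  show "(\<forall>x\<in>klein_quadric. quad j k a x \<ge> 0) \<longleftrightarrow> cmod a \<le> 2"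
    and "(\<forall>x\<in>klein_quadric. sqnorm x \<noteq> 0 \<longrightarrow> quad j k a x > 0) \<longleftrightarrow> cmod a < 2"
    using quad_criterion[where \<kappa> = 2 and X = klein_quadric, OF bound witness] by auto
qed

lemma quad_all:
  assumes "1 \<le> j" "j < k" "k \<le> 6" "j + k = 7"
  shows "(\<forall>x. quad j k a x \<ge> 0) \<longleftrightarrow> cmod a \<le> 1"
    and "(\<forall>x. sqnorm x \<noteq> 0 \<longrightarrow> quad j k a x > 0) \<longleftrightarrow> cmod a < 1"
proof -
  have bound: "2 * 1 * (cmod (x j) * cmod (x k)) \<le> sqnorm x" for x
  proof -
    have "2 * (cmod (x j) * cmod (x k)) \<le> (cmod (x j))\<^sup>2 + (cmod (x k))\<^sup>2"
      by (rule two_mult_le_squares)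
    also have "\<dots> = (\<Sum>l\<in>{j, k}. (cmod (x l))\<^sup>2)"
      using assms by simp
    also have "\<dots> \<le> sqnorm x"
      unfolding sqnorm_def using assms by (intro sum_mono2) auto
    finally show ?thesis by simp
  qed
  have witness: "\<exists>x\<in>UNIV. sqnorm x = 2 * 1 \<and> x k = 1 \<and> x j = - sgn a" if "a \<noteq> 0"
  proof -
    define x where "x i = (if i = j then - sgn a else if i = k then 1 else 0)" for i
    have "cmod (sgn a) = 1"
      using that by (simp add: norm_sgn)
    with assms have "sqnorm x = 2 * 1 \<and> x k = 1 \<and> x j = - sgn a"
      unfolding sqnorm_def sum_1_6
      by (cases rule: complementary_cases) (auto simp: x_def)
    then show ?thesis by blast
  qed
  show "(\<forall>x. quad j k a x \<ge> 0) \<longleftrightarrow> cmod a \<le> 1"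
    and "(\<forall>x. sqnorm x \<noteq> 0 \<longrightarrow> quad j k a x > 0) \<longleftrightarrow> cmod a < 1"
    using quad_criterion[where \<kappa> = 1 and X = UNIV, OF bound witness] by auto
qed

section \<open>Strongly positive forms\<close>

lemma real_Lambda_2_2_add: "\<Omega> \<in> real_Lambda_2_2 \<Longrightarrow> \<Theta> \<in> real_Lambda_2_2 \<Longrightarrow> \<Omega> + \<Theta> \<in> real_Lambda_2_2"
  by (simp add: real_Lambda_2_2_def Lambda_2_2_def conj_form_add forms.span_add)

lemma real_Lambda_2_2_zero: "0 \<in> real_Lambda_2_2"
  by (simp add: real_Lambda_2_2_def Lambda_2_2_def forms.span_zero)

lemma real_Lambda_2_2_scale: "\<Omega> \<in> real_Lambda_2_2 \<Longrightarrow> complex_of_real r *\<^sub>C \<Omega> \<in> real_Lambda_2_2"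
  by (simp add: real_Lambda_2_2_def Lambda_2_2_def conj_form_scale forms.span_scale)

lemma strongly_positive_add:
  assumes "strongly_positive \<Omega>" "strongly_positive \<Theta>"
  shows "strongly_positive (\<Omega> + \<Theta>)"
proof -
  obtain n \<psi> where 1: "\<forall>i<n. \<psi> i \<in> decomposable_2_0"
      "\<Omega> = (\<Sum>i<n::nat. \<psi> i \<^bold>\<and> conj_form (\<psi> i))"
    using assms(1) by (auto simp: strongly_positive_def)
  obtain m \<xi> where 2: "\<forall>i<m. \<xi> i \<in> decomposable_2_0"
      "\<Theta> = (\<Sum>i<m::nat. \<xi> i \<^bold>\<and> conj_form (\<xi> i))"
    using assms(2) by (auto simp: strongly_positive_def)
  define \<rho> where "\<rho> i = (if i < n then \<psi> i else \<xi> (i - n))" for i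
  have "(\<Sum>i<n + m. \<rho> i \<^bold>\<and> conj_form (\<rho> i))
      = (\<Sum>i<n. \<rho> i \<^bold>\<and> conj_form (\<rho> i)) + (\<Sum>i<m. \<rho> (n + i) \<^bold>\<and> conj_form (\<rho> (n + i)))"
    by (induction m) (simp_all add: add.assoc)
  also have "\<dots> = \<Omega> + \<Theta>"
    by (simp add: 1(2) 2(2) \<rho>_def)
  finally have "\<Omega> + \<Theta> = (\<Sum>i<n + m. \<rho> i \<^bold>\<and> conj_form (\<rho> i))" ..
  moreover have "\<forall>i<n + m. \<rho> i \<in> decomposable_2_0"
    using 1(1) 2(1) by (auto simp: \<rho>_def)
  ultimately show ?thesis
    using assms real_Lambda_2_2_add unfolding strongly_positive_def by blast
qed

lemma strongly_positive_zero: "strongly_positive 0"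
  unfolding strongly_positive_def
  by (intro conjI real_Lambda_2_2_zero exI[of _ "0::nat"] exI[of _ "\<lambda>_. 0"]) simp_all

lemma strongly_positive_sum:
  "(\<And>i. i \<in> I \<Longrightarrow> strongly_positive (f i)) \<Longrightarrow> strongly_positive (\<Sum>i\<in>I. f i)"
  by (induction I rule: infinite_finite_induct) (simp_all only: sum.infinite sum.empty
      sum.insert strongly_positive_zero strongly_positive_add insertI1 insertI2 not_False_eq_True simp_thms)

lemma nonneg_form_add:
  assumes "nonneg_form \<omega> \<alpha>" "nonneg_form \<omega> \<beta>"
  shows "nonneg_form \<omega> (\<alpha> + \<beta>)"
  using assms unfolding nonneg_form_def
  by (metis add_nonneg_nonneg forms.scale_left_distrib of_real_add)

lemma nonneg_form_sum:
  "(\<And>i. i < n \<Longrightarrow> nonneg_form \<omega> (f i)) \<Longrightarrow> nonneg_form \<omega> (\<Sum>i<n::nat. f i)"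
proof (induction n)
  case 0
  have "(0::form) = complex_of_real 0 *\<^sub>C Vol \<omega>"
    by simp
  then show ?case
    unfolding nonneg_form_def by auto
next
  case (Suc n)
  then show ?case
    unfolding sum.lessThan_Suc by (intro nonneg_form_add) auto
qed

context coframe
begin

lemma herm_form_sum: "(\<Sum>i\<in>I. herm_form (h i)) = herm_form (\<lambda>l m. \<Sum>i\<in>I. h i l m)"
proof (induction I rule: infinite_finite_induct)
  case (insert i I)
  then show ?case by (simp add: herm_form_add)
qed (simp_all add: herm_form_zero)

lemma herm_form_single:
  assumes "j \<in> {1..6}" "k \<in> {1..6}"
  shows "herm_form (\<lambda>l m. if l = j \<and> m = k then c else 0) = c *\<^sub>C (phi \<omega> j \<^bold>\<and> conj_form (phi \<omega> k))"
proof -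
  have "herm_form (\<lambda>l m. if l = j \<and> m = k then c else 0)
      = (\<Sum>l=1..6. \<Sum>m=1..6. if l = j \<and> m = k then c *\<^sub>C (phi \<omega> l \<^bold>\<and> conj_form (phi \<omega> m)) else 0)"
    unfolding herm_form_def by (intro sum.cong refl) auto
  also have "\<dots> = c *\<^sub>C (phi \<omega> j \<^bold>\<and> conj_form (phi \<omega> k))"
    by (rule sum_sum_delta) (use assms in auto)
  finally show ?thesis .
qed

lemma herm_form_diag:
  "herm_form (\<lambda>l m. if l = m then d l else 0)
    = (\<Sum>l=1..6. d l *\<^sub>C (phi \<omega> l \<^bold>\<and> conj_form (phi \<omega> l)))"
  unfolding herm_form_def
proof (intro sum.cong refl)
  fix l :: nat assume l: "l \<in> {1..6}"
  have "(\<Sum>m=1..6. (if l = m then d l else 0) *\<^sub>C (phi \<omega> l \<^bold>\<and> conj_form (phi \<omega> m)))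
      = (\<Sum>m=1..6. if l = m then d l *\<^sub>C (phi \<omega> l \<^bold>\<and> conj_form (phi \<omega> m)) else 0)"
    by (intro sum.cong refl) auto
  also have "\<dots> = d l *\<^sub>C (phi \<omega> l \<^bold>\<and> conj_form (phi \<omega> l))"
    using l by simp
  finally show "(\<Sum>m=1..6. (if l = m then d l else 0) *\<^sub>C (phi \<omega> l \<^bold>\<and> conj_form (phi \<omega> m)))
      = d l *\<^sub>C (phi \<omega> l \<^bold>\<and> conj_form (phi \<omega> l))" .
qed

lemma Omega_eq_herm_form:
  assumes "j \<in> {1..6}" "k \<in> {1..6}"
  shows "Omega \<omega> j k a = herm_form (omega_mat j k a)"
proof -
  have "(\<Sum>l=1..6. phi \<omega> l \<^bold>\<and> conj_form (phi \<omega> l)) = herm_form (\<lambda>l m. if l = m then 1 else 0)"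
    using herm_form_diag[of "\<lambda>_. 1"] by simp
  then show ?thesis
    unfolding Omega_def herm_form_single[OF assms, symmetric]
      herm_form_single[OF assms(2,1), symmetric]
    by (simp add: herm_form_add omega_mat_def[abs_def])
qed

lemma nonneg_form_iff: "nonneg_form \<omega> (complex_of_real r *\<^sub>C Vol \<omega>) \<longleftrightarrow> r \<ge> 0"
  using Vol_nonzero by (auto simp: nonneg_form_def)

lemma pos_form_iff: "pos_form \<omega> (complex_of_real r *\<^sub>C Vol \<omega>) \<longleftrightarrow> r > 0"
  using Vol_nonzero by (auto simp: pos_form_def)

lemma Omega_wedge:
  assumes "1 \<le> j" "j < k" "k \<le> 6" "j + k = 7"
  shows "Omega \<omega> j k a \<^bold>\<and> plucker_form x \<^bold>\<and> conj_form (plucker_form x)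
    = complex_of_real (quad j k a x) *\<^sub>C Vol \<omega>"
proof -
  have jk: "j \<in> {1..6}" "k \<in> {1..6}" "7 - j = k" "7 - k = j"
    using assms by auto
  let ?t = "\<lambda>l m. x (7 - l) * cnj (x (7 - m))"
  have "(\<Sum>l=1..6. \<Sum>m=1..6. omega_mat j k a l m * x (7 - l) * cnj (x (7 - m)))
      = (\<Sum>l=1..6. \<Sum>m=1..6. if l = m then ?t l m else 0)
      + (\<Sum>l=1..6. \<Sum>m=1..6. if l = j \<and> m = k then a * ?t l m else 0)
      + (\<Sum>l=1..6. \<Sum>m=1..6. if l = k \<and> m = j then cnj a * ?t l m else 0)"
    unfolding sum.distrib[symmetric]
    by (intro sum.cong refl) (auto simp: omega_mat_def algebra_simps)
  also have "(\<Sum>l=1..6. \<Sum>m=1..6. if l = j \<and> m = k then a * ?t l m else 0) = a * ?t j k"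
    by (rule sum_sum_delta) (use jk in auto)
  also have "(\<Sum>l=1..6. \<Sum>m=1..6. if l = k \<and> m = j then cnj a * ?t l m else 0) = cnj a * ?t k j"
    by (rule sum_sum_delta) (use jk in auto)
  also have "(\<Sum>l=1..6. \<Sum>m=1..6. if l = m then ?t l m else 0) = (\<Sum>l=1..6. ?t l l)"
    by (intro sum.cong refl) auto
  also have "\<dots> = complex_of_real (sqnorm x)"
    unfolding sqnorm_def sum_1_6 by (simp add: complex_norm_square del: of_real_power)
  also have "complex_of_real (sqnorm x) + a * ?t j k + cnj a * ?t k j
      = complex_of_real (quad j k a x)"
    using complex_add_cnj[of "a * x k * cnj (x j)"] jk by (simp add: quad_def mult_ac)
  finally show ?thesis
    using jk by (simp add: Omega_eq_herm_form herm_form_wedge)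
qed

lemma plucker_form_eq_0_iff: "plucker_form x = 0 \<longleftrightarrow> sqnorm x = 0"
proof
  assume 0: "plucker_form x = 0"
  have "x l = 0" if l: "l \<in> {1..6}" for l
  proof -
    have "(\<Sum>m=1..6. x m * (if 7 - m = 7 - l then 1 else 0)) = (\<Sum>m=1..6. if m = l then x m else 0)"
      using l by (intro sum.cong refl) auto
    also have "\<dots> = x l"
      using l by simp
    finally have "plucker_form x \<^bold>\<and> plucker_form (\<lambda>m. if m = 7 - l then 1 else 0) = x l *\<^sub>C top_form"
      unfolding plucker_form_wedge by simp
    then show ?thesis
      using 0 top_form_nonzero by simp
  qed
  then show "sqnorm x = 0"
    unfolding sqnorm_eq_0_iff by blast
next
  assume "sqnorm x = 0"
  then show "plucker_form x = 0"
    unfolding sqnorm_eq_0_iff by (simp add: plucker_form_def)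
qed

lemma decomposable_2_0_eq: "decomposable_2_0 = plucker_form ` klein_quadric"
  unfolding klein_quadric_def
  by (auto intro: plucker_form_decomposable elim: decomposable_imp_plucker_form)

lemma Omega_real:
  assumes "j \<in> {1..6}" "k \<in> {1..6}"
  shows "Omega \<omega> j k a \<in> real_Lambda_2_2"
  unfolding Omega_eq_herm_form[OF assms] real_Lambda_2_2_iff using omega_mat_hermitian by blast

lemma positivity_Omega:
  assumes "1 \<le> j" "j < k" "k \<le> 6" "j + k = 7"
  shows "weakly_positive \<omega> (Omega \<omega> j k a) \<longleftrightarrow> cmod a \<le> 2"
    and "strictly_weakly_positive \<omega> (Omega \<omega> j k a) \<longleftrightarrow> cmod a < 2"
    and "hermitian_positive \<omega> (Omega \<omega> j k a) \<longleftrightarrow> cmod a \<le> 1"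
    and "strictly_hermitian_positive \<omega> (Omega \<omega> j k a) \<longleftrightarrow> cmod a < 1"
proof -
  have real: "Omega \<omega> j k a \<in> real_Lambda_2_2"
    using assms by (intro Omega_real) auto
  show "weakly_positive \<omega> (Omega \<omega> j k a) \<longleftrightarrow> cmod a \<le> 2"
    using real quad_klein_quadric(1)[OF assms, of a]
    by (simp add: weakly_positive_def decomposable_2_0_eq Omega_wedge[OF assms] nonneg_form_iff)
  show "strictly_weakly_positive \<omega> (Omega \<omega> j k a) \<longleftrightarrow> cmod a < 2"
    using real quad_klein_quadric(2)[OF assms, of a]
    by (simp add: strictly_weakly_positive_def decomposable_2_0_eq Omega_wedge[OF assms]
        pos_form_iff plucker_form_eq_0_iff)
  show "hermitian_positive \<omega> (Omega \<omega> j k a) \<longleftrightarrow> cmod a \<le> 1"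
    using real quad_all(1)[OF assms, of a]
    by (simp add: hermitian_positive_def Lambda_2_0_eq Omega_wedge[OF assms] nonneg_form_iff)
  show "strictly_hermitian_positive \<omega> (Omega \<omega> j k a) \<longleftrightarrow> cmod a < 1"
    using real quad_all(2)[OF assms, of a]
    by (simp add: strictly_hermitian_positive_def Lambda_2_0_eq Omega_wedge[OF assms]
        pos_form_iff plucker_form_eq_0_iff)
qed

text \<open>
  For a single summand, \<open>\<psi> \<and> \<psi>\<^sup>* \<and> \<eta> \<and> \<eta>\<^sup>*\<close> equals \<open>|s|\<^sup>2\<close> times the volume form, where \<open>s\<close> is the
  coefficient of \<open>\<psi> \<and> \<eta>\<close>.
\<close>

lemma strongly_positive_imp_hermitian_positive:
  assumes "strongly_positive \<Omega>"
  shows "hermitian_positive \<omega> \<Omega>"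
  unfolding hermitian_positive_def
proof (intro conjI ballI)
  show "\<Omega> \<in> real_Lambda_2_2"
    using assms by (simp add: strongly_positive_def)
  obtain n \<psi> where \<psi>: "\<forall>i<n. \<psi> i \<in> decomposable_2_0"
      "\<Omega> = (\<Sum>i<n::nat. \<psi> i \<^bold>\<and> conj_form (\<psi> i))"
    using assms by (auto simp: strongly_positive_def)
  fix \<eta> assume "\<eta> \<in> Lambda_2_0"
  then obtain x where \<eta>: "\<eta> = plucker_form x"
    by (auto simp: Lambda_2_0_eq)
  have "nonneg_form \<omega> (\<psi> i \<^bold>\<and> conj_form (\<psi> i) \<^bold>\<and> \<eta> \<^bold>\<and> conj_form \<eta>)" if "i < n" for i
  proof -
    obtain y where y: "\<psi> i = plucker_form y"
      using \<psi>(1) \<open>i < n\<close> by (auto simp: decomposable_2_0_eq)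
    define s where "s = (\<Sum>l=1..6. y l * x (7 - l))"
    have "(\<Sum>l=1..6. \<Sum>m=1..6. y l * cnj (y m) * x (7 - l) * cnj (x (7 - m))) = s * cnj s"
      unfolding s_def cnj_sum sum_product by (intro sum.cong refl) simp
    also have "\<dots> = complex_of_real ((cmod s)\<^sup>2)"
      by (rule complex_norm_square[symmetric])
    finally show ?thesis
      by (simp only: y \<eta> plucker_form_wedge_conj herm_form_wedge nonneg_form_iff zero_le_power2)
  qed
  then show "nonneg_form \<omega> (\<Omega> \<^bold>\<and> \<eta> \<^bold>\<and> conj_form \<eta>)"
    unfolding \<psi>(2) wedge_sum_left by (rule nonneg_form_sum)
qed

lemma decomposable_2_0_scale:
  assumes "\<psi> \<in> decomposable_2_0"
  shows "c *\<^sub>C \<psi> \<in> decomposable_2_0"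
proof -
  obtain x where x: "\<psi> = plucker_form x" "x \<in> klein_quadric"
    using assms by (auto simp: decomposable_2_0_eq)
  have "c * x 1 * (c * x 6) + c * x 2 * (c * x 5) + c * x 3 * (c * x 4)
      = c\<^sup>2 * (x 1 * x 6 + x 2 * x 5 + x 3 * x 4)"
    by algebra
  then have "(\<lambda>l. c * x l) \<in> klein_quadric"
    using x(2) by (simp add: klein_quadric_def)
  then show ?thesis
    by (simp add: x(1) plucker_form_scale decomposable_2_0_eq)
qed

lemma strongly_positive_scale:
  assumes "strongly_positive \<Omega>" "r \<ge> 0"
  shows "strongly_positive (complex_of_real r *\<^sub>C \<Omega>)"
proof -
  obtain n \<psi> where \<psi>: "\<forall>i<n. \<psi> i \<in> decomposable_2_0"
      "\<Omega> = (\<Sum>i<n::nat. \<psi> i \<^bold>\<and> conj_form (\<psi> i))"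
    using assms by (auto simp: strongly_positive_def)
  let ?\<xi> = "\<lambda>i. complex_of_real (sqrt r) *\<^sub>C \<psi> i"
  have "complex_of_real (sqrt r) * complex_of_real (sqrt r) = complex_of_real r"
    using assms(2) by (metis of_real_mult real_sqrt_mult_self abs_of_nonneg)
  then have "complex_of_real r *\<^sub>C \<Omega> = (\<Sum>i<n. ?\<xi> i \<^bold>\<and> conj_form (?\<xi> i))"
    by (simp only: \<psi>(2) conj_form_scale wedge_scale_left wedge_scale_right forms.scale_sum_right
        forms.scale_scale complex_cnj_complex_of_real)
  moreover have "\<forall>i<n. ?\<xi> i \<in> decomposable_2_0"
    using \<psi>(1) decomposable_2_0_scale by blast
  moreover have "complex_of_real r *\<^sub>C \<Omega> \<in> real_Lambda_2_2"
    using assms(1) by (intro real_Lambda_2_2_scale) (simp add: strongly_positive_def)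
  ultimately show ?thesis
    unfolding strongly_positive_def by (intro conjI exI[of _ n] exI[of _ ?\<xi>])
qed

lemma strongly_positive_square:
  assumes "\<psi> \<in> decomposable_2_0"
  shows "strongly_positive (\<psi> \<^bold>\<and> conj_form \<psi>)"
proof -
  obtain x where "\<psi> = plucker_form x"
    using assms by (auto simp: decomposable_2_0_eq)
  then have "\<psi> \<^bold>\<and> conj_form \<psi> \<in> real_Lambda_2_2"
    unfolding real_Lambda_2_2_iff
    by (intro exI[of _ "\<lambda>l m. x l * cnj (x m)"])
      (simp add: plucker_form_wedge_conj hermitian_mat_def mult.commute)
  then show ?thesis
    unfolding strongly_positive_def using assms
    by (intro conjI exI[of _ 1] exI[of _ "\<lambda>_. \<psi>"]) simp_all
qed

lemma strongly_positive_rank_one: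
  assumes "x \<in> klein_quadric"
  shows "strongly_positive (herm_form (\<lambda>l m. x l * cnj (x m)))"
  using strongly_positive_square[of "plucker_form x"] assms
  by (simp add: decomposable_2_0_eq plucker_form_wedge_conj)

lemma strongly_positive_diag:
  assumes "\<And>l. l \<in> {1..6} \<Longrightarrow> d l \<ge> 0"
  shows "strongly_positive (herm_form (\<lambda>l m. if l = m then complex_of_real (d l) else 0))"
  unfolding herm_form_diag
  by (intro strongly_positive_sum strongly_positive_scale strongly_positive_square
      phi_decomposable assms)

text \<open>
  In both cases rank-one matrices of vectors on the Klein quadric account for the off-diagonal
  entries, and a non-negative diagonal matrix fills up the rest. For \<open>j + k \<noteq> 7\<close> the vector with entries
  \<open>1\<close> and \<open>c\<^sup>*\<close> is itself on the quadric. For \<open>j + k = 7\<close> it is not, and entries \<open>\<epsilon>\<close> and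
  \<open>- c\<^sup>* \<epsilon>\<^sup>*\<close> at a second complementary pair \<open>p\<close>, \<open>q\<close> are added. Their cross terms with the rest are
  multiples of \<open>\<epsilon>\<close>, \<open>\<epsilon>\<^sup>2\<close> or conjugates of these, so that they cancel in the average over
  \<open>\<epsilon> \<in> {1, \<i>, -1, -\<i>}\<close>.
\<close>

lemma strongly_positive_omega_mat:
  assumes "j \<in> {1..6}" "k \<in> {1..6}" "j \<noteq> k" "cmod c \<le> 1"
  shows "strongly_positive (herm_form (omega_mat j k c))"
proof -
  have "(cmod c)\<^sup>2 \<le> 1"
    using assms(4) by (simp add: power_le_one)
  have sq: "complex_of_real ((cmod c)\<^sup>2) = c * cnj c"
    by (rule complex_norm_square)
  then have sq': "(complex_of_real (cmod c))\<^sup>2 = c * cnj c"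
    by simp
  show ?thesis
  proof (cases "j + k = 7")
    case False
    define x where "x i = (if i = j then 1 else if i = k then cnj c else 0)" for i
    define d where "d i = (if i = j then 0 else if i = k then 1 - (cmod c)\<^sup>2 else 1)" for i
    have supp: "i = j \<or> i = k" if "x i \<noteq> 0" for i
      using that by (simp add: x_def split: if_splits)
    have "x u * x v = 0" if "u + v = 7" for u v
    proof (rule ccontr)
      assume "x u * x v \<noteq> 0"
      then have "u = j \<or> u = k" "v = j \<or> v = k"
        by (simp_all add: supp)
      then show False
        using False that by presburger
    qed
    from this[of 1 6] this[of 2 5] this[of 3 4] have "x \<in> klein_quadric"
      unfolding klein_quadric_def by auto
    then have "strongly_positive (herm_form (\<lambda>l m. x l * cnj (x m))
        + herm_form (\<lambda>l m. if l = m then complex_of_real (d l) else 0))"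
      using \<open>(cmod c)\<^sup>2 \<le> 1\<close>
      by (intro strongly_positive_add strongly_positive_rank_one strongly_positive_diag)
        (auto simp: d_def)
    moreover have "x l * cnj (x m) + (if l = m then complex_of_real (d l) else 0) = omega_mat j k c l m"
      for l m
      unfolding x_def d_def omega_mat_def using assms(3)
      by (cases "l = j"; cases "l = k"; cases "m = j"; cases "m = k"; simp add: sq')
    ultimately show ?thesis
      by (simp add: herm_form_add)
  next
    case True
    have jk: "j = 1 \<and> k = 6 \<or> j = 2 \<and> k = 5 \<or> j = 3 \<and> k = 4 \<or> j = 4 \<and> k = 3
        \<or> j = 5 \<and> k = 2 \<or> j = 6 \<and> k = 1"
      using True assms(1,2) unfolding atLeastAtMost_iff by presburger
    define p :: nat where "p = (if j \<in> {1, 6} then 2 else 1)"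
    define q where "q = 7 - p"
    have pq: "p \<noteq> j" "p \<noteq> k" "q \<noteq> j" "q \<noteq> k" "p \<noteq> q"
      using jk unfolding p_def q_def by (elim disjE conjE; simp)+
    define x where "x \<epsilon> i = (if i = j then 1 else if i = k then cnj c
        else if i = p then \<epsilon> else if i = q then - (cnj c * cnj \<epsilon>) else 0)" for \<epsilon> i
    define d where "d i = (if i \<in> {j, p} then 0 else if i \<in> {k, q} then 1 - (cmod c)\<^sup>2 else 1)" for i
    have "x \<epsilon> \<in> klein_quadric" if "cmod \<epsilon> = 1" for \<epsilon>
    proof -
      have "\<epsilon> * cnj \<epsilon> = 1"
        using that by (metis complex_norm_square of_real_1 power_one)
      with jk show ?thesis
        using \<open>\<epsilon> * cnj \<epsilon> = 1\<close> unfolding klein_quadric_def x_def p_def q_def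
        by (elim disjE conjE; simp)
    qed
    then have pos: "strongly_positive ((\<Sum>n<4::nat. complex_of_real (1/4) 
          *\<^sub>C herm_form (\<lambda>l m. x (\<i> ^ n) l * cnj (x (\<i> ^ n) m)))
        + herm_form (\<lambda>l m. if l = m then complex_of_real (d l) else 0))"
      using \<open>(cmod c)\<^sup>2 \<le> 1\<close>
      by (intro strongly_positive_add strongly_positive_rank_one strongly_positive_diag
          strongly_positive_sum strongly_positive_scale)
        (auto simp: d_def norm_power)
    have entries: "(\<Sum>n<4::nat. complex_of_real (1/4) * (x (\<i> ^ n) l * cnj (x (\<i> ^ n) m)))
        + (if l = m then complex_of_real (d l) else 0) = omega_mat j k c l m" for l m
    proof -
      have four: "(\<Sum>n<4::nat. f (\<i> ^ n)) = f 1 + f \<i> + f (- 1) + f (- \<i>)" for f :: "complex \<Rightarrow> complex"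
        by (simp add: eval_nat_numeral)
      have x_vals: "x \<epsilon> j = 1" "x \<epsilon> k = cnj c" "x \<epsilon> p = \<epsilon>" "x \<epsilon> q = - (cnj c * cnj \<epsilon>)"
          and x_out: "i \<notin> {j, k, p, q} \<Longrightarrow> x \<epsilon> i = 0" for \<epsilon> i
        using assms(3) pq by (simp_all add: x_def)
      have d_vals: "d j = 0" "d p = 0" "d k = 1 - (cmod c)\<^sup>2" "d q = 1 - (cmod c)\<^sup>2"
          and d_out: "i \<notin> {j, k, p, q} \<Longrightarrow> d i = 1" for i
        using assms(3) pq by (simp_all add: d_def)
      show ?thesis
      proof (cases "l \<in> {j, k, p, q} \<and> m \<in> {j, k, p, q}")
        case True
        then show ?thesis
          unfolding four[where f = "\<lambda>\<epsilon>. complex_of_real (1/4) * (x \<epsilon> l * cnj (x \<epsilon> m))"] omega_mat_def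
          by (elim conjE insertE emptyE; simp only: x_vals d_vals;
              use assms(3) pq in \<open>simp add: sq'\<close>)
      next
        case False
        then have off: "\<not> (l = j \<and> m = k)" "\<not> (l = k \<and> m = j)"
          by blast+
        have "omega_mat j k c l m = (if l = m then 1 else 0)"
          unfolding omega_mat_def if_not_P[OF off(1)] if_not_P[OF off(2)] by (simp only: add_0_right)
        moreover have "x \<epsilon> l = 0 \<or> x \<epsilon> m = 0" for \<epsilon>
          using False x_out by blast
        then have product: "x \<epsilon> l * cnj (x \<epsilon> m) = 0" for \<epsilon>
          by (metis complex_cnj_zero mult_zero_left mult_zero_right)
        have "(\<Sum>n<4::nat. complex_of_real (1/4) * (x (\<i> ^ n) l * cnj (x (\<i> ^ n) m))) = 0"
          by (simp only: product mult_zero_right sum.neutral_const)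
        moreover have "d l = 1" if "l = m"
          using False d_out that by blast
        ultimately show ?thesis
          by (cases "l = m") simp_all
      qed
    qed
    show ?thesis
      using pos unfolding herm_form_scale herm_form_sum herm_form_add entries .
  qed
qed

lemma strongly_positive_omega_mat_small:
  assumes "j \<in> {1..6}" "k \<in> {1..6}" "cmod c \<le> 1/2"
  shows "strongly_positive (herm_form (omega_mat j k c))"
proof (cases "j = k")
  case True
  have "omega_mat j k c l m
      = (if l = m then complex_of_real (1 + (if l = j then 2 * Re c else 0)) else 0)" for l m
    using complex_add_cnj[of c] True by (auto simp: omega_mat_def)
  moreover have "0 \<le> 1 + (if l = j then 2 * Re c else 0)" for l
    using assms(3) abs_Re_le_cmod[of c] by auto
  ultimately show ?thesis
    using strongly_positive_diag[of "\<lambda>l. 1 + (if l = j then 2 * Re c else 0)"] by presburger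
next
  case False
  then show ?thesis
    using assms by (intro strongly_positive_omega_mat) auto
qed

text \<open>
  Write \<open>h = |a| \<Omega>\<^bsub>sgn a\<^esub> + \<delta> I + E\<close> with \<open>\<delta> = 1 - |a|\<close> and \<open>E\<close> a small Hermitian matrix, where forms and
  their matrices are identified. The term \<open>\<delta> I + E\<close> is a sum over all 36 positions \<open>(l, m)\<close>
  of \<open>\<delta>/36\<close> times the matrix \<open>omega_mat l m\<close> with parameter
  \<open>(18/\<delta>) E\<^sub>l\<^sub>m\<close>; each entry of \<open>E\<close> arises in two halves, from \<open>(l, m)\<close> and, by
  Hermitian symmetry, from \<open>(m, l)\<close>.
\<close>

lemma strongly_positive_near_omega_mat:
  assumes jk: "j \<in> {1..6}" "k \<in> {1..6}" "j \<noteq> k" and "cmod a < 1" and "hermitian_mat h"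
    and near: "\<And>l m. l \<in> {1..6} \<Longrightarrow> m \<in> {1..6} \<Longrightarrow> cmod (h l m - omega_mat j k a l m) \<le> (1 - cmod a) / 36"
  shows "strongly_positive (herm_form h)"
proof -
  define \<delta> where "\<delta> = 1 - cmod a"
  have "\<delta> > 0"
    using assms(4) by (simp add: \<delta>_def)
  define E where "E l m = h l m - omega_mat j k a l m" for l m
  have E_herm: "cnj (E m l) = E l m" for l m
    using assms(5) omega_mat_hermitian[of j k a] unfolding hermitian_mat_def E_def
    by (metis complex_cnj_diff)
  let ?c = "\<lambda>l m. complex_of_real (18 / \<delta>) * E l m"
  have small: "cmod (?c l m) \<le> 1/2" if "l \<in> {1..6}" "m \<in> {1..6}" for l m
  proof -
    have "cmod (?c l m) = 18 / \<delta> * cmod (E l m)"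
      using \<open>\<delta> > 0\<close> by (simp add: norm_mult norm_divide)
    also have "\<dots> \<le> 18 / \<delta> * (\<delta> / 36)"
      using near[OF that] \<open>\<delta> > 0\<close> unfolding E_def \<delta>_def by (intro mult_left_mono) auto
    also have "\<dots> = 1/2"
      using \<open>\<delta> > 0\<close> by simp
    finally show ?thesis .
  qed
  have pos: "strongly_positive (complex_of_real (cmod a) *\<^sub>C herm_form (omega_mat j k (sgn a))
      + (\<Sum>l=1..6. \<Sum>m=1..6. complex_of_real (\<delta> / 36) *\<^sub>C herm_form (omega_mat l m (?c l m))))"
    using jk small \<open>\<delta> > 0\<close>
    by (intro strongly_positive_add strongly_positive_sum strongly_positive_scale
        strongly_positive_omega_mat strongly_positive_omega_mat_small) (auto simp: norm_sgn)
  have entries: "complex_of_real (cmod a) * omega_mat j k (sgn a) p q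
      + (\<Sum>l=1..6. \<Sum>m=1..6. complex_of_real (\<delta> / 36) * omega_mat l m (?c l m) p q) = h p q"
    if pq: "p \<in> {1..6}" "q \<in> {1..6}" for p q
  proof -
    have half: "complex_of_real (\<delta> / 36) * (complex_of_real (18 / \<delta>) * z) = z / 2" for z
      using \<open>\<delta> > 0\<close> by (simp add: field_simps)
    have "complex_of_real (\<delta> / 36) * omega_mat l m (?c l m) p q
        = (if p = q then complex_of_real (\<delta> / 36) else 0)
        + (if l = p \<and> m = q then E l m / 2 else 0)
        + (if l = q \<and> m = p then cnj (E l m) / 2 else 0)" for l m
      unfolding omega_mat_def distrib_left if_distrib[of "\<lambda>z. complex_of_real (\<delta> / 36) * z"]
        complex_cnj_mult complex_cnj_complex_of_real half
      by (cases "l = p"; cases "l = q"; cases "m = p"; cases "m = q"; simp)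
    then have "(\<Sum>l=1..6. \<Sum>m=1..6. complex_of_real (\<delta> / 36) * omega_mat l m (?c l m) p q)
        = (\<Sum>l=1..6::nat. \<Sum>m=1..6::nat. if p = q then complex_of_real (\<delta> / 36) else 0)
        + (\<Sum>l=1..6. \<Sum>m=1..6. if l = p \<and> m = q then E l m / 2 else 0)
        + (\<Sum>l=1..6. \<Sum>m=1..6. if l = q \<and> m = p then cnj (E l m) / 2 else 0)"
      by (simp only: sum.distrib)
    also have "(\<Sum>l=1..6. \<Sum>m=1..6. if l = p \<and> m = q then E l m / 2 else 0) = E p q / 2"
      by (rule sum_sum_delta) (use pq in auto)
    also have "(\<Sum>l=1..6. \<Sum>m=1..6. if l = q \<and> m = p then cnj (E l m) / 2 else 0) = cnj (E q p) / 2"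
      by (rule sum_sum_delta) (use pq in auto)
    also have "(\<Sum>l=1..6::nat. \<Sum>m=1..6::nat. if p = q then complex_of_real (\<delta> / 36) else 0)
        = (if p = q then complex_of_real \<delta> else 0)"
      by simp
    finally have "(\<Sum>l=1..6. \<Sum>m=1..6. complex_of_real (\<delta> / 36) * omega_mat l m (?c l m) p q)
        = (if p = q then complex_of_real \<delta> else 0) + E p q"
      by (simp add: E_herm)
    moreover have polar: "complex_of_real (cmod a) * sgn a = a"
      by (cases "a = 0") (simp_all add: sgn_eq)
    moreover have polar': "complex_of_real (cmod a) * cnj (sgn a) = cnj a"
      using arg_cong[OF polar, of cnj] by simp
    have "complex_of_real (cmod a) * omega_mat j k (sgn a) p q
        = omega_mat j k a p q - (if p = q then complex_of_real \<delta> else 0)"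
      unfolding omega_mat_def distrib_left if_distrib[of "\<lambda>z. complex_of_real (cmod a) * z"] polar polar'
      by (cases "p = q"; simp add: \<delta>_def)
    ultimately show ?thesis
      by (simp add: E_def)
  qed
  have "complex_of_real (cmod a) *\<^sub>C herm_form (omega_mat j k (sgn a))
      + (\<Sum>l=1..6. \<Sum>m=1..6. complex_of_real (\<delta> / 36) *\<^sub>C herm_form (omega_mat l m (?c l m)))
      = herm_form h"
    unfolding herm_form_scale herm_form_sum herm_form_add by (rule herm_form_cong) (rule entries)
  with pos show ?thesis
    by simp
qed

section \<open>The interior of the strongly positive cone\<close>

text \<open>
  Every coefficient is recovered by an exterior product, so it is a continuous function of the form in
  the topology of pointwise convergence.
\<close>
lemma herm_form_coeff:
  assumes "l \<in> {1..6}" "m \<in> {1..6}"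
  shows "herm_form h \<^bold>\<and> phi \<omega> (7 - l) \<^bold>\<and> conj_form (phi \<omega> (7 - m)) = h l m *\<^sub>C Vol \<omega>"
proof -
  have "(\<Sum>p=1..6. \<Sum>q=1..6. h p q * (if 7 - p = 7 - l then 1 else 0) * cnj (if 7 - q = 7 - m then 1 else 0))
      = (\<Sum>p=1..6. \<Sum>q=1..6. if p = l \<and> q = m then h p q else 0)"
    using assms by (intro sum.cong refl) auto
  also have "\<dots> = h l m"
    by (rule sum_sum_delta) (use assms in auto)
  finally have "(\<Sum>p=1..6. \<Sum>q=1..6. h p q * (if 7 - p = 7 - l then 1 else 0)
      * cnj (if 7 - q = 7 - m then 1 else 0)) = h l m" .
  moreover have "7 - l \<in> {1..6}" "7 - m \<in> {1..6}"
    using assms by auto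
  ultimately show ?thesis
    by (simp only: phi_eq_plucker_form herm_form_wedge)
qed

lemma continuous_on_wedge_left: "continuous_on UNIV (\<lambda>\<Theta>. (\<Theta> \<^bold>\<and> \<beta>) vs)"
  unfolding wedge_def by (intro continuous_intros continuous_on_product_coordinates)

text \<open>
  If \<open>|a| < 1\<close>, forms whose coefficients are close to those of \<open>\<Omega>\<^sub>a\<close> are strongly positive. If \<open>\<Omega>\<^sub>a\<close>
  is an interior point, then \<open>\<Omega>\<^sub>a - t \<Omega>\<^sub>0\<close> is strongly positive for some \<open>t > 0\<close>, hence Hermitian
  positive, which bounds the quadratic form of \<open>\<Omega>\<^sub>a\<close> below by \<open>t \<Sum> |x\<^sub>l|\<^sup>2\<close>.
\<close>

lemma strictly_strongly_positive_Omega: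
  assumes "1 \<le> j" "j < k" "k \<le> 6" "j + k = 7"
  shows "strictly_strongly_positive (Omega \<omega> j k a) \<longleftrightarrow> cmod a < 1"
proof
  have jk: "j \<in> {1..6}" "k \<in> {1..6}" "j \<noteq> k"
    using assms by auto
  assume "cmod a < 1"
  obtain vs where vs: "Vol \<omega> vs \<noteq> 0"
    using Vol_nonzero by (auto simp: fun_eq_iff)
  define coeff where "coeff l m \<Theta> = (\<Theta> \<^bold>\<and> (phi \<omega> (7 - l) \<^bold>\<and> conj_form (phi \<omega> (7 - m)))) vs / Vol \<omega> vs"
    for l m \<Theta>
  have coeff: "coeff l m (herm_form h) = h l m" if "l \<in> {1..6}" "m \<in> {1..6}" for h l m
    using herm_form_coeff[OF that, of h] vs by (simp add: coeff_def wedge_assoc scale_form_def)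
  define T where "T = (\<Inter>l\<in>{1..6}. \<Inter>m\<in>{1..6}.
      {\<Theta>. cmod (coeff l m \<Theta> - omega_mat j k a l m) < (1 - cmod a) / 36})"
  have "open T"
    unfolding T_def coeff_def using vs
    by (intro open_INT ballI open_Collect_less continuous_intros continuous_on_wedge_left) auto
  moreover have "Omega \<omega> j k a \<in> T"
    using jk \<open>cmod a < 1\<close> by (auto simp: T_def Omega_eq_herm_form coeff)
  moreover have "strongly_positive \<Theta>" if \<Theta>: "\<Theta> \<in> real_Lambda_2_2" "\<Theta> \<in> T" for \<Theta>
  proof -
    obtain h where h: "hermitian_mat h" "\<Theta> = herm_form h"
      using \<Theta>(1) by (auto simp: real_Lambda_2_2_iff)
    have "cmod (h l m - omega_mat j k a l m) \<le> (1 - cmod a) / 36" if "l \<in> {1..6}" "m \<in> {1..6}" for l m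
      using \<Theta>(2) that unfolding T_def h(2) by (auto simp: coeff less_imp_le)
    then show ?thesis
      unfolding h(2) by (rule strongly_positive_near_omega_mat[OF jk \<open>cmod a < 1\<close> h(1)])
  qed
  ultimately show "strictly_strongly_positive (Omega \<omega> j k a)"
    unfolding strictly_strongly_positive_def interior_of_def
    using Omega_real[OF jk(1,2), of a] openin_open_Int[of T real_Lambda_2_2] by blast
next
  have jk: "j \<in> {1..6}" "k \<in> {1..6}" "j \<noteq> k"
    using assms by auto
  assume "strictly_strongly_positive (Omega \<omega> j k a)"
  then obtain T where T: "open T" "Omega \<omega> j k a \<in> T"
      "\<And>\<Theta>. \<Theta> \<in> real_Lambda_2_2 \<Longrightarrow> \<Theta> \<in> T \<Longrightarrow> strongly_positive \<Theta>"
    unfolding strictly_strongly_positive_def interior_of_def openin_open by auto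
  define f where "f t = Omega \<omega> j k a + complex_of_real (- t) *\<^sub>C Omega \<omega> j k 0" for t
  have "continuous_on UNIV f"
    unfolding f_def scale_form_def plus_fun_def
    by (intro continuous_on_coordinatewise_then_product continuous_intros)
  then have "open (f -` T)"
    using T(1) by (simp add: continuous_on_open_vimage)
  moreover have "0 \<in> f -` T"
    using T(2) by (simp add: f_def)
  ultimately obtain e where e: "e > 0" "ball 0 e \<subseteq> f -` T"
    using openE by blast
  define t where "t = e / 2"
  have t: "t > 0" "f t \<in> T"
    using e by (auto simp: t_def subset_iff)
  have "f t \<in> real_Lambda_2_2"
    unfolding f_def by (intro real_Lambda_2_2_add real_Lambda_2_2_scale Omega_real jk)
  then have "hermitian_positive \<omega> (f t)"
    using T(3) t(2) strongly_positive_imp_hermitian_positive by blast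
  have nonneg: "quad j k a x \<ge> t * sqnorm x" for x
  proof -
    have "f t \<^bold>\<and> plucker_form x \<^bold>\<and> conj_form (plucker_form x)
        = complex_of_real (quad j k a x) *\<^sub>C Vol \<omega> + complex_of_real (- t) *\<^sub>C complex_of_real (quad j k 0 x) *\<^sub>C Vol \<omega>"
      by (simp only: f_def wedge_add_left wedge_scale_left Omega_wedge[OF assms])
    also have "\<dots> = complex_of_real (quad j k a x - t * sqnorm x) *\<^sub>C Vol \<omega>"
      by (simp add: quad_def scale_form_def fun_eq_iff algebra_simps)
    finally have "f t \<^bold>\<and> plucker_form x \<^bold>\<and> conj_form (plucker_form x)
        = complex_of_real (quad j k a x - t * sqnorm x) *\<^sub>C Vol \<omega>" .
    moreover have "nonneg_form \<omega> (f t \<^bold>\<and> plucker_form x \<^bold>\<and> conj_form (plucker_form x))"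
      using \<open>hermitian_positive \<omega> (f t)\<close> by (simp add: hermitian_positive_def Lambda_2_0_eq)
    ultimately have "0 \<le> quad j k a x - t * sqnorm x"
      by (simp only: nonneg_form_iff)
    then show ?thesis
      by simp
  qed
  have "quad j k a x > 0" if "sqnorm x \<noteq> 0" for x
  proof -
    have "t * sqnorm x > 0"
      using t(1) that sqnorm_nonneg[of x] by simp
    then show ?thesis
      using nonneg[of x] by linarith
  qed
  then show "cmod a < 1"
    using quad_all(2)[OF assms, of a] by blast
qed

lemma strongly_positive_Omega:
  assumes "1 \<le> j" "j < k" "k \<le> 6" "j + k = 7"
  shows "strongly_positive (Omega \<omega> j k a) \<longleftrightarrow> cmod a \<le> 1"
proof
  assume "strongly_positive (Omega \<omega> j k a)"
  then show "cmod a \<le> 1"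
    using strongly_positive_imp_hermitian_positive positivity_Omega(3)[OF assms] by blast
next
  assume "cmod a \<le> 1"
  then show "strongly_positive (Omega \<omega> j k a)"
    using assms by (simp add: Omega_eq_herm_form strongly_positive_omega_mat)
qed

end

theorem theorem4p12:
  fixes \<omega> :: "nat \<Rightarrow> form" and j k :: nat and a :: complex
  assumes "basis_1_0 \<omega>"
    and "1 \<le> j" and "j < k" and "k \<le> 6"
    and "j + k = 7"
  shows "(weakly_positive \<omega> (Omega \<omega> j k a) \<longleftrightarrow> cmod a \<le> 2)
    \<and> (strictly_weakly_positive \<omega> (Omega \<omega> j k a) \<longleftrightarrow> cmod a < 2)
    \<and> ((hermitian_positive \<omega> (Omega \<omega> j k a) \<longleftrightarrow> strongly_positive (Omega \<omega> j k a))
      \<and> (strongly_positive (Omega \<omega> j k a) \<longleftrightarrow> cmod a \<le> 1))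
    \<and> ((strictly_hermitian_positive \<omega> (Omega \<omega> j k a)
          \<longleftrightarrow> strictly_strongly_positive (Omega \<omega> j k a))
      \<and> (strictly_strongly_positive (Omega \<omega> j k a) \<longleftrightarrow> cmod a < 1))"
proof -
  interpret coframe \<omega>
    by unfold_locales (rule assms(1))
  show ?thesis
    using positivity_Omega[OF assms(2-5), of a] strongly_positive_Omega[OF assms(2-5), of a]
      strictly_strongly_positive_Omega[OF assms(2-5), of a]
    by blast
qed

end
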